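(* Let $G$ be a countable group, let $n\in\mathbb{N}$, and for $i=1,\dots,n$ let $\Theta_i:G\to\Pi_{k\to\omega}P_{m_k^i}$ be a sofic representation and $\lambda_i\geq 0$ with $\sum_{i=1}^n\lambda_i=1$. Let $\sum_{i=1}^n\lambda_i\Theta_i=\oplus_{i=1}^n(\Theta_i\otimes 1_{r_k^i})$, where the $r_k^i$ are any natural numbers such that $\lim_{k\to\omega}m_k^jr_k^j/\sum_{i=1}^nm_k^ir_k^i=\lambda_j$ for every $j=1,\dots,n$. Then $[\sum_{i=1}^n\lambda_i\Theta_i]\in Sof(G,P^\omega)$ is well defined, i.e. it depends only on the classes $[\Theta_i]$ and the numbers $\lambda_i$, $i=1,\dots,n$ (and not on the choice of the representatives $\Theta_i$ nor of the numbers $r_k^i$).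
   Context: Fix a free ultrafilter $\omega$ on $\mathbb{N}$; "natural number" means positive integer. $M_n$ is the algebra of complex $n\times n$ matrices, $Tr$ denotes the normalized trace on $M_n$ (so $Tr(Id)=1$), $\|x\|_2=Tr(x^*x)^{1/2}$. $P_n\subset M_n$ is the group of permutation matrices. For $(n_k)_k\subset\mathbb{N}$ with $\lim_{k\to\infty}n_k=\infty$, $\Pi_{k\to\omega}M_{n_k}$ is the quotient of the algebra of operator-norm bounded sequences $(x_k)_k$, $x_k\in M_{n_k}$, by the ideal of sequences with $\lim_{k\to\omega}\|x_k\|_2=0$; the class of $(x_k)_k$ is written $\Pi_{k\to\omega}x_k$, and $Tr(\Pi_{k\to\omega}x_k)=\lim_{k\to\omega}Tr(x_k)$. $\Pi_{k\to\omega}P_{n_k}$ is the subset of classes of sequences of permutation matrices. A sofic representation of $G$ is a group morphism $\Theta:G\to\Pi_{k\to\omega}P_{n_k}$ with $Tr(\Theta(g))=0$ for all $g\neq e$, where $(n_k)_k$ is any sequence of natural numbers with $n_k\to\infty$. Writing $\Theta=\Pi_{k\to\omega}\theta_k$ with $\theta_k:G\to P_{n_k}$ maps, for a sequence of natural numbers $(r_k)_k$ the amplification is $\Theta\otimes 1_{r_k}=\Pi_{k\to\omega}\theta_k\otimes 1_{r_k}:G\to\Pi_{k\to\omega}P_{n_kr_k}$; for $\Phi=\Pi_{k\to\omega}\phi_k:G\to\Pi_{k\to\omega}P_{m_k}$ the direct sum is $\Theta\oplus\Phi=\Pi_{k\to\omega}\theta_k\oplus\phi_k:G\to\Pi_{k\to\omega}P_{n_k+m_k}$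 (similarly for $n$ summands). $Sof(G,P^\omega)$ is the set of sofic representations of $G$ modulo the equivalence: $(\Theta_1:G\to\Pi_{k\to\omega}P_{n_k})\sim(\Theta_2:G\to\Pi_{k\to\omega}P_{m_k})$ iff there are sequences of natural numbers $(r_k)_k,(t_k)_k$ with $n_kr_k=m_kt_k$ for all $k$ and $u\in\Pi_{k\to\omega}P_{n_kr_k}$ with $\Theta_2\otimes 1_{t_k}=Ad\,u\circ(\Theta_1\otimes 1_{r_k})$, where $Ad\,u(x)=uxu^*$. $[\Theta]$ denotes the class of $\Theta$. *)

theory Defs
  imports
    "HOL-Analysis.Analysis"
    "HOL-Algebra.QuotRing"
    "HOL-Combinatorics.Permutations"
    "Jordan_Normal_Form.Schur_Decomposition"
begin

definition free_ultrafilter :: "nat filter \<Rightarrow> bool" where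
  "free_ultrafilter \<omega> \<longleftrightarrow>
     \<omega> \<noteq> bot \<and>
     (\<forall>P. eventually P \<omega> \<or> eventually (\<lambda>k. \<not> P k) \<omega>) \<and>
     (\<forall>P. eventually P \<omega> \<longrightarrow> infinite {k. P k})"

definition norm_tr :: "complex mat \<Rightarrow> complex" where
  "norm_tr A = (\<Sum>i<dim_row A. A $$ (i, i)) / of_nat (dim_row A)"

definition norm2 :: "complex mat \<Rightarrow> real" where
  "norm2 A = sqrt (Re (norm_tr (mat_adjoint A * A)))"

definition vec_norm2 :: "complex Matrix.vec \<Rightarrow> real" where
  "vec_norm2 v = sqrt (Re (v \<bullet>c v))"

definition op_norm :: "complex mat \<Rightarrow> real" where
  "op_norm A = Sup {vec_norm2 (A *\<^sub>v v) | v. v \<in> carrier_vec (dim_col A) \<and> vec_norm2 v \<le> 1}"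

definition perm_mats :: "nat \<Rightarrow> complex mat set" where
  "perm_mats n = {Matrix.mat n n (\<lambda>(i, j). if i = p j then 1 else 0) | p. p permutes {..<n}}"

definition kronecker :: "complex mat \<Rightarrow> complex mat \<Rightarrow> complex mat" where
  "kronecker A B = Matrix.mat (dim_row A * dim_row B) (dim_col A * dim_col B)
     (\<lambda>(i, j). A $$ (i div dim_row B, j div dim_col B) * B $$ (i mod dim_row B, j mod dim_col B))"

definition bounded_seqs :: "(nat \<Rightarrow> nat) \<Rightarrow> (nat \<Rightarrow> complex mat) ring" where
  "bounded_seqs n =
     \<lparr>carrier = {x. (\<forall>k. x k \<in> carrier_mat (n k) (n k)) \<and> (\<exists>C. \<forall>k. op_norm (x k) \<le> C)},
      monoid.mult = \<lambda>x y k. x k * y k,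
      one = \<lambda>k. 1\<^sub>m (n k),
      zero = \<lambda>k. 0\<^sub>m (n k) (n k),
      add = \<lambda>x y k. x k + y k\<rparr>"

definition null_seqs :: "nat filter \<Rightarrow> (nat \<Rightarrow> nat) \<Rightarrow> (nat \<Rightarrow> complex mat) set" where
  "null_seqs \<omega> n = {x \<in> carrier (bounded_seqs n). ((\<lambda>k. norm2 (x k)) \<longlongrightarrow> 0) \<omega>}"

definition mat_ultra :: "nat filter \<Rightarrow> (nat \<Rightarrow> nat) \<Rightarrow> (nat \<Rightarrow> complex mat) set ring" where
  "mat_ultra \<omega> n = bounded_seqs n Quot null_seqs \<omega> n"

definition ultra_class ::
    "nat filter \<Rightarrow> (nat \<Rightarrow> nat) \<Rightarrow> (nat \<Rightarrow> complex mat) \<Rightarrow> (nat \<Rightarrow> complex mat) set" where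
  "ultra_class \<omega> n x = null_seqs \<omega> n +>\<^bsub>bounded_seqs n\<^esub> x"

definition ultra_tr :: "nat filter \<Rightarrow> (nat \<Rightarrow> complex mat) set \<Rightarrow> complex" where
  "ultra_tr \<omega> X = (THE t. \<forall>x\<in>X. ((\<lambda>k. norm_tr (x k)) \<longlongrightarrow> t) \<omega>)"

definition ultra_adjoint :: "(nat \<Rightarrow> complex mat) set \<Rightarrow> (nat \<Rightarrow> complex mat) set" where
  "ultra_adjoint X = (\<lambda>x k. mat_adjoint (x k)) ` X"

definition perm_seqs :: "(nat \<Rightarrow> nat) \<Rightarrow> (nat \<Rightarrow> complex mat) set" where
  "perm_seqs n = {x. \<forall>k. x k \<in> perm_mats (n k)}"

definition perm_ultra :: "nat filter \<Rightarrow> (nat \<Rightarrow> nat) \<Rightarrow> (nat \<Rightarrow> complex mat) set set" where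
  "perm_ultra \<omega> n = ultra_class \<omega> n ` perm_seqs n"

definition ultra_Ad ::
    "nat filter \<Rightarrow> (nat \<Rightarrow> nat) \<Rightarrow> (nat \<Rightarrow> complex mat) set
      \<Rightarrow> (nat \<Rightarrow> complex mat) set \<Rightarrow> (nat \<Rightarrow> complex mat) set" where
  "ultra_Ad \<omega> n u X = u \<otimes>\<^bsub>mat_ultra \<omega> n\<^esub> X \<otimes>\<^bsub>mat_ultra \<omega> n\<^esub> ultra_adjoint u"

text \<open>A map from \<open>G\<close> to an ultraproduct is carried together with its sequence of dimensions.
  Only its values on \<^term>\<open>carrier G\<close> are meaningful.\<close>

type_synonym 'g ultra_rep = "(nat \<Rightarrow> nat) \<times> ('g \<Rightarrow> (nat \<Rightarrow> complex mat) set)"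

definition sofic_reps :: "nat filter \<Rightarrow> ('g, 'h) monoid_scheme \<Rightarrow> 'g ultra_rep set" where
  "sofic_reps \<omega> G =
     {(n, \<Theta>). (\<forall>k. n k > 0) \<and> filterlim n at_top sequentially \<and>
        \<Theta> \<in> hom G ((mat_ultra \<omega> n)\<lparr>carrier := perm_ultra \<omega> n\<rparr>) \<and>
        (\<forall>g\<in>carrier G. g \<noteq> \<one>\<^bsub>G\<^esub> \<longrightarrow> ultra_tr \<omega> (\<Theta> g) = 0)}"

text \<open>In the next two definitions the union runs over all lifts to sequences of permutation
  matrices; the class does not depend on the lift, so this is the usual way (as in
  \<^const>\<open>rcoset_mult\<close>) of defining an operation on cosets through representatives.\<close>

definition amplify :: "nat filter \<Rightarrow> (nat \<Rightarrow> nat) \<Rightarrow> 'g ultra_rep \<Rightarrow> 'g ultra_rep" where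
  "amplify \<omega> r = (\<lambda>(n, \<Theta>).
     (\<lambda>k. n k * r k,
      \<lambda>g. \<Union>x \<in> \<Theta> g \<inter> perm_seqs n.
            ultra_class \<omega> (\<lambda>k. n k * r k) (\<lambda>k. kronecker (x k) (1\<^sub>m (r k)))))"

definition direct_sum :: "nat filter \<Rightarrow> nat \<Rightarrow> (nat \<Rightarrow> 'g ultra_rep) \<Rightarrow> 'g ultra_rep" where
  "direct_sum \<omega> n \<Phi> =
     (\<lambda>k. \<Sum>i=1..n. fst (\<Phi> i) k,
      \<lambda>g. \<Union>x \<in> {x. \<forall>i\<in>{1..n}. x i \<in> snd (\<Phi> i) g \<inter> perm_seqs (fst (\<Phi> i))}.
            ultra_class \<omega> (\<lambda>k. \<Sum>i=1..n. fst (\<Phi> i) k)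
              (\<lambda>k. diag_block_mat (map (\<lambda>i. x i k) [1..<Suc n])))"

definition sof_equiv ::
    "nat filter \<Rightarrow> ('g, 'h) monoid_scheme \<Rightarrow> ('g ultra_rep \<times> 'g ultra_rep) set" where
  "sof_equiv \<omega> G =
     {((n, \<Theta>\<^sub>1), (m, \<Theta>\<^sub>2)). (n, \<Theta>\<^sub>1) \<in> sofic_reps \<omega> G \<and> (m, \<Theta>\<^sub>2) \<in> sofic_reps \<omega> G \<and>
        (\<exists>r t. (\<forall>k. r k > 0 \<and> t k > 0 \<and> n k * r k = m k * t k) \<and>
          (\<exists>u \<in> perm_ultra \<omega> (\<lambda>k. n k * r k). \<forall>g\<in>carrier G.
             snd (amplify \<omega> t (m, \<Theta>\<^sub>2)) g =
             ultra_Ad \<omega> (\<lambda>k. n k * r k) u (snd (amplify \<omega> r (n, \<Theta>\<^sub>1)) g)))}"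

definition Sof :: "nat filter \<Rightarrow> ('g, 'h) monoid_scheme \<Rightarrow> 'g ultra_rep set set" where
  "Sof \<omega> G = sofic_reps \<omega> G // sof_equiv \<omega> G"

definition sof_class ::
    "nat filter \<Rightarrow> ('g, 'h) monoid_scheme \<Rightarrow> 'g ultra_rep \<Rightarrow> 'g ultra_rep set" where
  "sof_class \<omega> G \<Phi> = sof_equiv \<omega> G `` {\<Phi>}"

text \<open>Below, \<open>m i k\<close> and \<open>r i k\<close> are the dimension and the multiplicity of the \<open>i\<close>-th
  summand at index \<open>k\<close>. Multiplicities are positive even where the weight is \<open>0\<close>.\<close>

definition admissible ::
    "nat filter \<Rightarrow> nat \<Rightarrow> (nat \<Rightarrow> nat \<Rightarrow> nat) \<Rightarrow> (nat \<Rightarrow> real) \<Rightarrow> (nat \<Rightarrow> nat \<Rightarrow> nat) \<Rightarrow> bool" where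
  "admissible \<omega> n m w r \<longleftrightarrow>
     (\<forall>i\<in>{1..n}. \<forall>k. r i k > 0) \<and>
     (\<forall>j\<in>{1..n}.
        ((\<lambda>k. real (m j k * r j k) / real (\<Sum>i=1..n. m i k * r i k)) \<longlongrightarrow> w j) \<omega>)"

definition convex_comb ::
    "nat filter \<Rightarrow> nat \<Rightarrow> (nat \<Rightarrow> 'g ultra_rep) \<Rightarrow> (nat \<Rightarrow> nat \<Rightarrow> nat) \<Rightarrow> 'g ultra_rep" where
  "convex_comb \<omega> n \<Phi> r = direct_sum \<omega> n (\<lambda>i. amplify \<omega> (r i) (\<Phi> i))"

text \<open>Admissible multiplicities always exist, so a statement about all of them is not vacuous.\<close>

lemma admissible_exists:
  fixes w :: "nat \<Rightarrow> real" and m :: "nat \<Rightarrow> nat \<Rightarrow> nat"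
  assumes uf: "free_ultrafilter \<omega>"
    and w: "\<forall>i\<in>{1..n}. w i \<ge> 0" "(\<Sum>i=1..n. w i) = 1"
    and m: "\<forall>i\<in>{1..n}. \<forall>k. m i k > 0"
  shows "\<exists>r. admissible \<omega> n m w r"
proof -
  have le: "\<omega> \<le> sequentially"
  proof (rule filter_leI)
    fix P assume "eventually P sequentially"
    then have "finite {k. \<not> P k}"
      by (simp add: eventually_cofinite flip: cofinite_eq_sequentially)
    then show "eventually P \<omega>"
      using uf unfolding free_ultrafilter_def by blast
  qed
  define M where "M = (\<lambda>k. \<Sum>i=1..n. m i k)"
  define K where "K = (\<lambda>k. (real k + 1) * real (M k))"
  define r where "r = (\<lambda>i k. Suc (nat \<lfloor>w i * K k / real (m i k)\<rfloor>))"
  define S where "S = (\<lambda>k. real (\<Sum>i=1..n. m i k * r i k))"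
  have n: "n \<ge> 1" using w(2) by (cases n) auto
  have Mpos: "M k > 0" for k
    using n m unfolding M_def by (intro sum_pos) auto
  have Kpos: "K k > 0" for k using Mpos[of k] by (simp add: K_def)
  have bd: "w i * K k \<le> real (m i k * r i k) \<and> real (m i k * r i k) \<le> w i * K k + real (m i k)"
    if i: "i \<in> {1..n}" for i k
  proof -
    have mp: "real (m i k) > 0" using m i by auto
    define q where "q = w i * K k / real (m i k)"
    have q0: "q \<ge> 0" using w(1) i Kpos[of k] mp unfolding q_def by (auto intro!: mult_nonneg_nonneg divide_nonneg_pos less_imp_le)
    have rr: "real (r i k) = of_int \<lfloor>q\<rfloor> + 1"
      using q0 by (simp add: r_def q_def)
    then have "q \<le> real (r i k)" "real (r i k) \<le> q + 1" by linarith+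
    then have "real (m i k) * q \<le> real (m i k) * real (r i k)"
      "real (m i k) * real (r i k) \<le> real (m i k) * (q + 1)"
      using mp by (auto intro!: mult_left_mono)
    moreover have "real (m i k) * q = w i * K k" using mp by (simp add: q_def)
    ultimately show ?thesis by (simp add: distrib_left)
  qed
  have Slo: "S k \<ge> K k" for k
  proof -
    have "K k = (\<Sum>i=1..n. w i * K k)" using w(2) by (simp flip: sum_distrib_right)
    also have "\<dots> \<le> (\<Sum>i=1..n. real (m i k * r i k))" by (rule sum_mono) (use bd in blast)
    finally show ?thesis by (simp add: S_def)
  qed
  have Sup: "S k \<le> K k + real (M k)" for k
  proof -
    have "S k = (\<Sum>i=1..n. real (m i k * r i k))" by (simp add: S_def)
    also have "\<dots> \<le> (\<Sum>i=1..n. w i * K k + real (m i k))"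
      by (rule sum_mono) (use bd in blast)
    also have "\<dots> = K k + real (M k)"
      using w(2) by (simp add: sum.distrib M_def flip: sum_distrib_right)
    finally show ?thesis .
  qed
  have lim: "(\<lambda>k. real (m j k * r j k) / S k) \<longlonglongrightarrow> w j" if j: "j \<in> {1..n}" for j
  proof (rule tendsto_sandwich[where f = "\<lambda>k. w j * ((real k + 1) / (real k + 2))"
        and h = "\<lambda>k. w j + 1 / (real k + 1)"])
    have wj: "w j \<ge> 0" using w j by auto
    have mM: "real (m j k) \<le> real (M k)" for k
      unfolding M_def of_nat_le_iff by (rule member_le_sum) (use j in auto)
    show "\<forall>\<^sub>F k in sequentially. w j * ((real k + 1) / (real k + 2)) \<le> real (m j k * r j k) / S k"
    proof (rule always_eventually, rule allI)
      fix k
      have "K k + real (M k) = (real k + 2) * real (M k)" by (simp add: K_def algebra_simps)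
      then have "w j * ((real k + 1) / (real k + 2)) = w j * K k / (K k + real (M k))"
        using Mpos[of k] by (simp add: K_def)
      also have "\<dots> \<le> w j * K k / S k"
        by (rule divide_left_mono)
           (use Sup[of k] Slo[of k] Kpos[of k] wj in \<open>auto intro!: mult_pos_pos add_pos_nonneg\<close>)
      also have "\<dots> \<le> real (m j k * r j k) / S k"
        by (rule divide_right_mono) (use bd[OF j, of k] Slo[of k] Kpos[of k] in auto)
      finally show "w j * ((real k + 1) / (real k + 2)) \<le> real (m j k * r j k) / S k" .
    qed
    show "\<forall>\<^sub>F k in sequentially. real (m j k * r j k) / S k \<le> w j + 1 / (real k + 1)"
    proof (rule always_eventually, rule allI)
      fix k
      have "real (m j k * r j k) / S k \<le> (w j * K k + real (M k)) / S k"
        by (rule divide_right_mono)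
           (use bd[OF j, of k] mM[of k] Slo[of k] Kpos[of k] in auto)
      also have "\<dots> \<le> (w j * K k + real (M k)) / K k"
        by (rule divide_left_mono)
           (use Slo[of k] Kpos[of k] wj in \<open>auto intro!: mult_pos_pos add_nonneg_nonneg\<close>)
      also have "\<dots> = w j + 1 / (real k + 1)"
        using Mpos[of k] by (simp add: K_def add_divide_distrib)
      finally show "real (m j k * r j k) / S k \<le> w j + 1 / (real k + 1)" .
    qed
    show "(\<lambda>k. w j * ((real k + 1) / (real k + 2))) \<longlonglongrightarrow> w j"
    proof -
      have "(\<lambda>k. (real k + 1) / (real k + 2)) \<longlonglongrightarrow> 1" 
      proof -
        have "(\<lambda>k. 1 - inverse (real (k + 2))) \<longlonglongrightarrow> 1 - 0"
          by (intro tendsto_diff tendsto_const LIMSEQ_ignore_initial_segment lim_inverse_n)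
        moreover have "(\<lambda>k. 1 - inverse (real (k + 2))) = (\<lambda>k. (real k + 1) / (real k + 2))"
          by (auto simp: field_simps)
        ultimately show ?thesis by simp
      qed
      then show ?thesis using tendsto_mult[OF tendsto_const] by fastforce
    qed
    show "(\<lambda>k. w j + 1 / (real k + 1)) \<longlonglongrightarrow> w j"
      using tendsto_add[OF tendsto_const LIMSEQ_inverse_real_of_nat, of "w j"]
      by (simp add: inverse_eq_divide add.commute)
  qed
  have "((\<lambda>k. real (m j k * r j k) / S k) \<longlongrightarrow> w j) \<omega>" if "j \<in> {1..n}" for j
    using lim[OF that] le by (rule tendsto_mono[rotated])
  then have "admissible \<omega> n m w r"
    unfolding admissible_def S_def by (simp add: r_def)
  then show ?thesis by blast
qed

end

theory Submission
  imports Defs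
begin

text \<open>The statement is about permutations only up to a vanishing normalized Hamming distance. For
permutation matrices, \<open>norm2 (P\<^sub>s - P\<^sub>t)\<^sup>2\<close> is twice the proportion of the
points at which \<open>s\<close> and \<open>t\<close> differ. Hence two sequences of permutations define
the same class in the ultraproduct iff the proportion of their disagreements tends to \<open>0\<close>
along \<open>\<omega>\<close> (\<open>perm_class_eq_iff\<close>); products and adjoints of classes are computed by composing
and inverting permutations, and the trace of a class vanishes iff the proportion of fixed points
tends to \<open>0\<close>. The norm estimates serve to show that the null sequences form an ideal,
so that the operations on classes can be computed on representatives. In this language
amplifications compose strictly (\<open>amp_amp\<close>) and commute strictly with direct sums
(\<open>amp_dirsum\<close>), and a convex combination of sofic representations is sofic because the
proportion of disagreements, or of fixed points, in a direct sum is at most the sum of those in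
its summands.

The heart of the matter is \<open>convex_comb_equiv\<close>. Suppose that \<open>\<Theta>\<^sub>i \<otimes> 1\<close> with multiplicity \<open>s\<^sub>i\<close> is
conjugate by \<open>u\<^sub>i\<close> to \<open>\<Theta>'\<^sub>i \<otimes> 1\<close> with multiplicity \<open>t\<^sub>i\<close>, both in dimension
\<open>d\<^sub>i = m\<^sub>i s\<^sub>i = m'\<^sub>i t\<^sub>i\<close>, and let \<open>M\<close> and \<open>M'\<close> be the dimensions of the two convex combinations. Amplify
the first one by \<open>A = M' Q\<close> and the second one by \<open>B = M Q\<close>, where \<open>Q\<close> is the product of all
\<open>s\<^sub>j t\<^sub>j\<close>. Both now have dimension \<open>D = M A = M' B\<close>; their \<open>i\<close>-th summands consist of
\<open>a\<^sub>i = r\<^sub>i A / s\<^sub>i\<close> copies of the amplified \<open>\<Theta>\<^sub>i\<close> and of \<open>b\<^sub>i = r'\<^sub>i B / t\<^sub>i\<close> copies of the amplified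
\<open>\<Theta>'\<^sub>i\<close>, and all these copies have size \<open>d\<^sub>i\<close>. On \<open>min a\<^sub>i b\<^sub>i\<close> copies, \<open>u\<^sub>i\<close> carries the first to the second;
the points that are left are matched arbitrarily. In the \<open>i\<close>-th summands this leaves, on one side,
\<open>d\<^sub>i \<bar>a\<^sub>i - b\<^sub>i\<bar> = D \<bar>m\<^sub>i r\<^sub>i / M - m'\<^sub>i r'\<^sub>i / M'\<bar>\<close> points, which is \<open>o(D)\<close> along \<open>\<omega>\<close>
because both ratios tend to the same weight. The matching is independent of the group element, so
it conjugates one representation into the other in the ultraproduct.\<close>

section \<open>Operator norm and normalized Hilbert-Schmidt norm\<close>

lemma vec_norm2_L2_set:
  "vec_norm2 v = L2_set (\<lambda>i. cmod (vec_index v i)) {..<dim_vec v}"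
  unfolding vec_norm2_def L2_set_def scalar_prod_def
  by (simp add: lessThan_atLeast0 flip: complex_norm_square)

lemma vec_norm2_nonneg: "vec_norm2 v \<ge> 0"
  by (simp add: vec_norm2_L2_set L2_set_nonneg)

lemma vec_norm2_smult: "vec_norm2 (c \<cdot>\<^sub>v v) = cmod c * vec_norm2 v"
  by (simp add: vec_norm2_L2_set norm_mult L2_set_right_distrib cong: L2_set_cong_simp)

lemma vec_norm2_eq_0_iff: "vec_norm2 v = 0 \<longleftrightarrow> v = 0\<^sub>v (dim_vec v)"
  by (auto simp: vec_norm2_L2_set L2_set_eq_0_iff) (metis index_zero_vec(1))

lemma vec_norm2_zero: "vec_norm2 (0\<^sub>v n) = 0"
  by (simp add: vec_norm2_eq_0_iff)

lemma vec_norm2_add: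
  assumes "v \<in> carrier_vec n" "u \<in> carrier_vec n"
  shows "vec_norm2 (v + u) \<le> vec_norm2 v + vec_norm2 u"
proof -
  have "vec_norm2 (v + u) \<le> L2_set (\<lambda>i. cmod (vec_index v i) + cmod (vec_index u i)) {..<n}"
    using assms unfolding vec_norm2_L2_set by (auto intro!: L2_set_mono norm_triangle_ineq)
  also have "\<dots> \<le> vec_norm2 v + vec_norm2 u"
    using assms unfolding vec_norm2_L2_set by (auto intro!: L2_set_triangle_ineq)
  finally show ?thesis .
qed

lemma cmod_cscalar_prod_le:
  assumes "v \<in> carrier_vec n" "u \<in> carrier_vec n"
  shows "cmod (v \<bullet>c u) \<le> vec_norm2 v * vec_norm2 u"
proof -
  have "cmod (v \<bullet>c u) \<le> (\<Sum>i<n. \<bar>cmod (vec_index v i)\<bar> * \<bar>cmod (vec_index u i)\<bar>)"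
    using assms unfolding scalar_prod_def
    by (auto simp: lessThan_atLeast0 norm_mult intro!: order_trans[OF norm_sum])
  also have "\<dots> \<le> vec_norm2 v * vec_norm2 u"
    using assms L2_set_mult_ineq[of "\<lambda>i. cmod (vec_index v i)" "\<lambda>i. cmod (vec_index u i)" "{..<n}"]
    by (simp add: vec_norm2_L2_set)
  finally show ?thesis .
qed

text \<open>A finite bound for the set whose supremum is \<^const>\<open>op_norm\<close>, which would otherwise be an
unspecified real number: the Cauchy-Schwarz inequality in each row bounds a matrix by the \<open>\<ell>\<^sup>2\<close>-norm
of its entries.\<close>

lemma mat_bounded:
  shows "\<exists>C\<ge>0. \<forall>v\<in>carrier_vec (dim_col A). vec_norm2 (A *\<^sub>v v) \<le> C * vec_norm2 v"
proof (intro exI[of _ "L2_set (\<lambda>i. L2_set (\<lambda>j. cmod (A $$ (i, j))) {..<dim_col A}) {..<dim_row A}"] conjI ballI L2_set_nonneg)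
  fix v :: "complex Matrix.vec" assume v: "v \<in> carrier_vec (dim_col A)"
  have row: "cmod (vec_index (A *\<^sub>v v) i)
      \<le> L2_set (\<lambda>j. cmod (A $$ (i, j))) {..<dim_col A} * vec_norm2 v" if i: "i < dim_row A" for i
  proof -
    have "cmod (vec_index (A *\<^sub>v v) i) \<le>
        (\<Sum>j<dim_col A. \<bar>cmod (A $$ (i, j))\<bar> * \<bar>cmod (vec_index v j)\<bar>)"
      using i v unfolding scalar_prod_def mult_mat_vec_def
      by (auto simp: lessThan_atLeast0 norm_mult scalar_prod_def intro!: order_trans[OF norm_sum])
    also have "\<dots> \<le> L2_set (\<lambda>j. cmod (A $$ (i, j))) {..<dim_col A} * vec_norm2 v"
      using v L2_set_mult_ineq[of "\<lambda>j. cmod (A $$ (i, j))" "\<lambda>j. cmod (vec_index v j)" "{..<dim_col A}"]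
      by (simp add: vec_norm2_L2_set)
    finally show ?thesis .
  qed
  show "vec_norm2 (A *\<^sub>v v) \<le>
      L2_set (\<lambda>i. L2_set (\<lambda>j. cmod (A $$ (i, j))) {..<dim_col A}) {..<dim_row A} * vec_norm2 v"
    unfolding vec_norm2_L2_set[of "A *\<^sub>v v"]
    using row by (auto simp: L2_set_left_distrib vec_norm2_nonneg intro!: L2_set_mono)
qed

lemma bdd_above_op_norm:
  "bdd_above {vec_norm2 (A *\<^sub>v v) | v. v \<in> carrier_vec (dim_col A) \<and> vec_norm2 v \<le> 1}"
proof -
  obtain C where C: "C \<ge> 0" "\<forall>v\<in>carrier_vec (dim_col A). vec_norm2 (A *\<^sub>v v) \<le> C * vec_norm2 v"
    using mat_bounded by blast
  have "x \<le> C" if "x \<in> {vec_norm2 (A *\<^sub>v v) | v. v \<in> carrier_vec (dim_col A) \<and> vec_norm2 v \<le> 1}" for x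
  proof -
    from that obtain v where v: "x = vec_norm2 (A *\<^sub>v v)" "v \<in> carrier_vec (dim_col A)" "vec_norm2 v \<le> 1"
      by blast
    then have "x \<le> C * vec_norm2 v" using C by blast
    also have "\<dots> \<le> C" using C(1) v(3) by (simp add: mult_left_le)
    finally show ?thesis .
  qed
  then show ?thesis by (rule bdd_aboveI)
qed

lemma vec_norm2_mult_le_op_norm:
  assumes v: "v \<in> carrier_vec (dim_col A)"
  shows "vec_norm2 (A *\<^sub>v v) \<le> op_norm A * vec_norm2 v"
proof (cases "vec_norm2 v = 0")
  case True
  then show ?thesis using mat_bounded[of A] v by fastforce
next
  case False
  then have pos: "vec_norm2 v > 0" using vec_norm2_nonneg[of v] by linarith
  \<comment> \<open>Rescaling \<open>v\<close> to a unit vector puts it into the set that defines \<^const>\<open>op_norm\<close>.\<close>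
  define c where "c = complex_of_real (inverse (vec_norm2 v))"
  have cn: "cmod c = inverse (vec_norm2 v)" using pos unfolding c_def norm_of_real by simp
  have "vec_norm2 (A *\<^sub>v (c \<cdot>\<^sub>v v)) \<le> op_norm A"
    unfolding op_norm_def
    by (rule cSup_upper[OF _ bdd_above_op_norm]) (use v cn pos in \<open>auto simp: vec_norm2_smult\<close>)
  moreover have "A *\<^sub>v (c \<cdot>\<^sub>v v) = c \<cdot>\<^sub>v (A *\<^sub>v v)"
    using v by (intro mult_mat_vec[of _ "dim_row A" "dim_col A"]) auto
  ultimately have "inverse (vec_norm2 v) * vec_norm2 (A *\<^sub>v v) \<le> op_norm A"
    by (simp add: vec_norm2_smult cn)
  then show ?thesis using pos by (simp add: field_simps)
qed

lemma op_norm_le: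
  assumes "C \<ge> 0" "\<And>v. v \<in> carrier_vec (dim_col A) \<Longrightarrow> vec_norm2 (A *\<^sub>v v) \<le> C * vec_norm2 v"
  shows "op_norm A \<le> C"
  unfolding op_norm_def
proof (rule cSup_least)
  show "{vec_norm2 (A *\<^sub>v v) | v. v \<in> carrier_vec (dim_col A) \<and> vec_norm2 v \<le> 1} \<noteq> {}"
    using vec_norm2_zero[of "dim_col A"] zero_carrier_vec[of "dim_col A"] by fastforce
  fix x assume "x \<in> {vec_norm2 (A *\<^sub>v v) | v. v \<in> carrier_vec (dim_col A) \<and> vec_norm2 v \<le> 1}"
  then obtain v where v: "x = vec_norm2 (A *\<^sub>v v)" "v \<in> carrier_vec (dim_col A)" "vec_norm2 v \<le> 1"
    by blast
  then have "x \<le> C * vec_norm2 v" using assms(2) by blast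
  also have "\<dots> \<le> C" using assms(1) v(3) by (simp add: mult_left_le)
  finally show "x \<le> C" .
qed

lemma op_norm_nonneg: "op_norm A \<ge> 0"
proof -
  have "vec_norm2 (A *\<^sub>v 0\<^sub>v (dim_col A)) \<le> op_norm A"
    unfolding op_norm_def
  proof (rule cSup_upper[OF _ bdd_above_op_norm], rule CollectI, intro exI conjI)
    show "0\<^sub>v (dim_col A) \<in> carrier_vec (dim_col A)" by simp
    show "vec_norm2 (0\<^sub>v (dim_col A)) \<le> 1" by (simp add: vec_norm2_zero)
  qed simp
  then show ?thesis using vec_norm2_nonneg order_trans by blast
qed

lemma op_norm_add:
  assumes "A \<in> carrier_mat n n" "B \<in> carrier_mat n n"
  shows "op_norm (A + B) \<le> op_norm A + op_norm B"
proof (rule op_norm_le)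
  fix v :: "complex Matrix.vec" assume "v \<in> carrier_vec (dim_col (A + B))"
  then have v: "v \<in> carrier_vec n" using assms by simp
  have "vec_norm2 ((A + B) *\<^sub>v v) \<le> vec_norm2 (A *\<^sub>v v) + vec_norm2 (B *\<^sub>v v)"
    using assms v by (simp add: add_mult_distrib_mat_vec[OF assms v] vec_norm2_add[of _ n])
  also have "\<dots> \<le> op_norm A * vec_norm2 v + op_norm B * vec_norm2 v"
    using assms v by (intro add_mono vec_norm2_mult_le_op_norm) auto
  finally show "vec_norm2 ((A + B) *\<^sub>v v) \<le> (op_norm A + op_norm B) * vec_norm2 v"
    by (simp add: distrib_right)
qed (simp add: op_norm_nonneg)

lemma op_norm_mult:
  assumes "A \<in> carrier_mat n n" "B \<in> carrier_mat n n"
  shows "op_norm (A * B) \<le> op_norm A * op_norm B"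
proof (rule op_norm_le)
  fix v :: "complex Matrix.vec" assume "v \<in> carrier_vec (dim_col (A * B))"
  then have v: "v \<in> carrier_vec n" using assms by simp
  have "vec_norm2 ((A * B) *\<^sub>v v) = vec_norm2 (A *\<^sub>v (B *\<^sub>v v))"
    using assms v by (simp add: assoc_mult_mat_vec[OF assms v])
  also have "\<dots> \<le> op_norm A * vec_norm2 (B *\<^sub>v v)"
    using assms v by (intro vec_norm2_mult_le_op_norm) auto
  also have "\<dots> \<le> op_norm A * (op_norm B * vec_norm2 v)"
    using assms v by (intro mult_left_mono vec_norm2_mult_le_op_norm op_norm_nonneg) auto
  finally show "vec_norm2 ((A * B) *\<^sub>v v) \<le> (op_norm A * op_norm B) * vec_norm2 v"
    by simp
qed (simp add: op_norm_nonneg)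

lemma op_norm_uminus: "op_norm (- A) \<le> op_norm A"
proof (rule op_norm_le)
  fix v :: "complex Matrix.vec" assume "v \<in> carrier_vec (dim_col (- A))"
  then have v: "v \<in> carrier_vec (dim_col A)" by simp
  then have "- A *\<^sub>v v = (-1) \<cdot>\<^sub>v (A *\<^sub>v v)" by (intro eq_vecI) auto
  then show "vec_norm2 (- A *\<^sub>v v) \<le> op_norm A * vec_norm2 v"
    using vec_norm2_mult_le_op_norm[OF v] by (simp add: vec_norm2_smult)
qed (simp add: op_norm_nonneg)

lemma mat_adjoint_index:
  fixes A :: "complex mat"
  assumes "A \<in> carrier_mat n n"
  shows "mat_adjoint A \<in> carrier_mat n n"
    and "i < n \<Longrightarrow> j < n \<Longrightarrow> mat_adjoint A $$ (i, j) = cnj (A $$ (j, i))"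
  using assms by (auto simp: mat_adjoint_def mat_of_rows_def)

lemma mat_adjoint_adjoint:
  fixes A :: "complex mat"
  assumes "A \<in> carrier_mat n n"
  shows "mat_adjoint (mat_adjoint A) = A"
proof (rule eq_matI)
  note 1 = mat_adjoint_index[OF assms] and 2 = mat_adjoint_index[OF mat_adjoint_index(1)[OF assms]]
  show "mat_adjoint (mat_adjoint A) $$ (i, j) = A $$ (i, j)" if "i < dim_row A" "j < dim_col A" for i j
    using that 1 2 assms by auto
  show "dim_row (mat_adjoint (mat_adjoint A)) = dim_row A" "dim_col (mat_adjoint (mat_adjoint A)) = dim_col A"
    using 2 assms by auto
qed

lemma mat_adjoint_mult:
  fixes A :: "complex mat"
  assumes "A \<in> carrier_mat n n" "B \<in> carrier_mat n n"
  shows "mat_adjoint (A * B) = mat_adjoint B * mat_adjoint A"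
proof (rule eq_matI)
  have AB: "A * B \<in> carrier_mat n n" using assms by simp
  note a = mat_adjoint_index[OF assms(1)] and b = mat_adjoint_index[OF assms(2)]
   and ab = mat_adjoint_index[OF AB]
  show "dim_row (mat_adjoint (A * B)) = dim_row (mat_adjoint B * mat_adjoint A)"
    "dim_col (mat_adjoint (A * B)) = dim_col (mat_adjoint B * mat_adjoint A)"
    using a b ab by auto
  fix i j assume "i < dim_row (mat_adjoint B * mat_adjoint A)" "j < dim_col (mat_adjoint B * mat_adjoint A)"
  then have i: "i < n" and j: "j < n" using a b by auto
  then show "mat_adjoint (A * B) $$ (i, j) = (mat_adjoint B * mat_adjoint A) $$ (i, j)"
    using assms a b ab by (simp add: scalar_prod_def times_mat_def mult.commute)
qed

text \<open>With \<open>u = A* v\<close>, the identity \<open>\<parallel>u\<parallel>\<^sup>2 = \<langle>v, A u\<rangle>\<close> gives \<open>\<parallel>u\<parallel>\<^sup>2 \<le> \<parallel>v\<parallel> \<parallel>A\<parallel> \<parallel>u\<parallel>\<close>, and one factor \<open>\<parallel>u\<parallel>\<close> cancels.\<close>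

lemma op_norm_adjoint:
  assumes A: "A \<in> carrier_mat n n"
  shows "op_norm (mat_adjoint A) \<le> op_norm A"
proof (rule op_norm_le)
  note a = mat_adjoint_index[OF A]
  fix v :: "complex Matrix.vec" assume "v \<in> carrier_vec (dim_col (mat_adjoint A))"
  then have v: "v \<in> carrier_vec n" using a by auto
  define u where "u = mat_adjoint A *\<^sub>v v"
  have u: "u \<in> carrier_vec n" unfolding u_def using a v by auto
  have "u \<bullet>c u = (\<Sum>i<n. \<Sum>j<n. cnj (A $$ (j, i)) * vec_index v j * cnj (vec_index u i))"
    unfolding scalar_prod_def using u v a(1)
    by (auto simp: lessThan_atLeast0 u_def scalar_prod_def sum_distrib_right a(2) intro!: sum.cong)
  also have "\<dots> = (\<Sum>j<n. \<Sum>i<n. cnj (A $$ (j, i)) * vec_index v j * cnj (vec_index u i))"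
    by (rule sum.swap)
  also have "\<dots> = v \<bullet>c (A *\<^sub>v u)"
    unfolding scalar_prod_def using u v A
    by (auto simp: lessThan_atLeast0 scalar_prod_def sum_distrib_left intro!: sum.cong)
  finally have "(vec_norm2 u)\<^sup>2 = Re (v \<bullet>c (A *\<^sub>v u))"
    using vec_norm2_nonneg[of u] unfolding vec_norm2_def by (metis real_sqrt_ge_0_iff real_sqrt_pow2)
  also have "\<dots> \<le> cmod (v \<bullet>c (A *\<^sub>v u))" by (rule complex_Re_le_cmod)
  also have "\<dots> \<le> vec_norm2 v * vec_norm2 (A *\<^sub>v u)"
    using A u v by (intro cmod_cscalar_prod_le[of _ n]) auto
  also have "\<dots> \<le> vec_norm2 v * (op_norm A * vec_norm2 u)"
    using A u by (intro mult_left_mono vec_norm2_mult_le_op_norm vec_norm2_nonneg) auto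
  finally have "vec_norm2 u * vec_norm2 u \<le> (op_norm A * vec_norm2 v) * vec_norm2 u"
    by (simp add: power2_eq_square algebra_simps)
  then show "vec_norm2 (mat_adjoint A *\<^sub>v v) \<le> op_norm A * vec_norm2 v"
    using vec_norm2_nonneg[of u] vec_norm2_nonneg[of v] op_norm_nonneg[of A]
    by (fold u_def) (cases "vec_norm2 u = 0"; simp)
qed (simp add: op_norm_nonneg)

lemma norm2_L2_set:
  assumes A: "A \<in> carrier_mat n n"
  shows "norm2 A = L2_set (\<lambda>(i, j). cmod (A $$ (i, j))) ({..<n} \<times> {..<n}) / sqrt (real n)"
proof -
  note a = mat_adjoint_index[OF A]
  have d: "dim_row (mat_adjoint A * A) = n" using a by auto
  have "(\<Sum>i<n. (mat_adjoint A * A) $$ (i, i)) =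
      (\<Sum>i<n. \<Sum>j<n. complex_of_real ((cmod (A $$ (j, i)))\<^sup>2))"
    using A a by (auto simp: scalar_prod_def times_mat_def lessThan_atLeast0
      mult.commute[of "cnj _"] complex_norm_square[simplified] intro!: sum.cong)
  also have "\<dots> = complex_of_real (\<Sum>(i, j)\<in>{..<n} \<times> {..<n}. (cmod (A $$ (i, j)))\<^sup>2)"
    by (subst sum.swap) (simp add: sum.cartesian_product)
  finally have "norm_tr (mat_adjoint A * A) =
      complex_of_real ((\<Sum>(i, j)\<in>{..<n} \<times> {..<n}. (cmod (A $$ (i, j)))\<^sup>2) / real n)"
    unfolding norm_tr_def d by simp
  then show ?thesis unfolding norm2_def L2_set_def
    by (simp only: Re_complex_of_real real_sqrt_divide case_prod_unfold)
qed

lemma norm2_nonneg: "A \<in> carrier_mat n n \<Longrightarrow> norm2 A \<ge> 0"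
  by (simp add: norm2_L2_set L2_set_nonneg)

lemma norm2_add:
  assumes A: "A \<in> carrier_mat n n" and B: "B \<in> carrier_mat n n"
  shows "norm2 (A + B) \<le> norm2 A + norm2 B"
proof -
  have "L2_set (\<lambda>(i, j). cmod ((A + B) $$ (i, j))) ({..<n} \<times> {..<n})
    \<le> L2_set (\<lambda>x. cmod (A $$ x) + cmod (B $$ x)) ({..<n} \<times> {..<n})"
    using A B by (auto intro!: L2_set_mono norm_triangle_ineq)
  also have "\<dots> \<le> L2_set (\<lambda>x. cmod (A $$ x)) ({..<n} \<times> {..<n}) + L2_set (\<lambda>x. cmod (B $$ x)) ({..<n} \<times> {..<n})"
    by (rule L2_set_triangle_ineq)
  finally show ?thesis
    using norm2_L2_set[OF A] norm2_L2_set[OF B] norm2_L2_set[OF add_carrier_mat[OF B], of A]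
    by (simp add: divide_right_mono case_prod_unfold flip: add_divide_distrib)
qed

lemma norm2_uminus: "A \<in> carrier_mat n n \<Longrightarrow> norm2 (- A) = norm2 A"
  by (simp add: norm2_L2_set[of _ n] L2_set_def case_prod_unfold cong: sum.cong) 
     (auto intro!: arg_cong[where f = sqrt] arg_cong2[where f = "(/)"] sum.cong)

lemma norm2_adjoint:
  assumes A: "A \<in> carrier_mat n n"
  shows "norm2 (mat_adjoint A) = norm2 A"
proof -
  note a = mat_adjoint_index[OF A]
  have "(\<Sum>(i, j)\<in>{..<n} \<times> {..<n}. (cmod (mat_adjoint A $$ (i, j)))\<^sup>2) =
     (\<Sum>i<n. \<Sum>j<n. (cmod (A $$ (j, i)))\<^sup>2)"
    unfolding sum.cartesian_product[symmetric] by (simp add: a(2))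
  also have "\<dots> = (\<Sum>(i, j)\<in>{..<n} \<times> {..<n}. (cmod (A $$ (i, j)))\<^sup>2)"
    by (subst sum.swap) (simp add: sum.cartesian_product)
  finally show ?thesis
    unfolding norm2_L2_set[OF A] norm2_L2_set[OF a(1)] L2_set_def by (simp add: case_prod_unfold)
qed

text \<open>The columns of \<open>A B\<close> are the images under \<open>A\<close> of the columns of \<open>B\<close>, and the squared Hilbert-Schmidt
norm is the sum of the squared norms of the columns.\<close>

lemma norm2_mult_left:
  assumes A: "A \<in> carrier_mat n n" and B: "B \<in> carrier_mat n n"
  shows "norm2 (A * B) \<le> op_norm A * norm2 B"
proof -
  have AB: "A * B \<in> carrier_mat n n" using A B by simp
  have cols: "L2_set (\<lambda>(i, j). cmod (C $$ (i, j))) ({..<n} \<times> {..<n}) =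
      L2_set (\<lambda>j. vec_norm2 (col C j)) {..<n}" if C: "C \<in> carrier_mat n n" for C
  proof -
    have "(\<Sum>(i, j)\<in>{..<n} \<times> {..<n}. (cmod (C $$ (i, j)))\<^sup>2) = (\<Sum>j<n. \<Sum>i<n. (cmod (C $$ (i, j)))\<^sup>2)"
      by (subst sum.swap) (simp add: sum.cartesian_product)
    also have "\<dots> = (\<Sum>j<n. (vec_norm2 (col C j))\<^sup>2)"
      using C by (auto simp: vec_norm2_L2_set L2_set_def sum_nonneg intro!: sum.cong)
    finally show ?thesis by (simp add: L2_set_def case_prod_unfold)
  qed
  have "L2_set (\<lambda>j. vec_norm2 (col (A * B) j)) {..<n}
      \<le> L2_set (\<lambda>j. op_norm A * vec_norm2 (col B j)) {..<n}"
  proof (rule L2_set_mono)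
    fix j assume "j \<in> {..<n}"
    then show "vec_norm2 (col (A * B) j) \<le> op_norm A * vec_norm2 (col B j)"
      using A B vec_norm2_mult_le_op_norm[of "col B j" A] col_mult2[OF A B, of j] by auto
  qed (rule vec_norm2_nonneg)
  also have "\<dots> = op_norm A * L2_set (\<lambda>j. vec_norm2 (col B j)) {..<n}"
    by (simp add: L2_set_right_distrib op_norm_nonneg)
  finally show ?thesis
    unfolding norm2_L2_set[OF AB] norm2_L2_set[OF B] cols[OF AB] cols[OF B]
    by (simp add: divide_right_mono)
qed

lemma norm2_mult_right:
  assumes A: "A \<in> carrier_mat n n" and B: "B \<in> carrier_mat n n"
  shows "norm2 (A * B) \<le> norm2 A * op_norm B"
proof -
  note a = mat_adjoint_index(1)[OF A] and b = mat_adjoint_index(1)[OF B]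
  have "norm2 (A * B) = norm2 (mat_adjoint B * mat_adjoint A)"
    using A B by (simp add: norm2_adjoint[of _ n] flip: mat_adjoint_mult)
  also have "\<dots> \<le> op_norm (mat_adjoint B) * norm2 (mat_adjoint A)"
    by (rule norm2_mult_left[OF b a])
  also have "\<dots> \<le> op_norm B * norm2 A"
    unfolding norm2_adjoint[OF A] by (intro mult_right_mono op_norm_adjoint[OF B] norm2_nonneg[OF A])
  finally show ?thesis by (simp add: mult.commute)
qed

text \<open>This makes the trace constant on classes modulo null sequences.\<close>

lemma norm_tr_le_norm2:
  assumes A: "A \<in> carrier_mat n n"
  shows "cmod (norm_tr A) \<le> norm2 A"
proof (cases "n = 0")
  case True
  then show ?thesis using A by (simp add: norm_tr_def norm2_L2_set[OF A])
next
  case False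
  have "cmod (\<Sum>i<n. A $$ (i, i)) \<le> (\<Sum>i<n. \<bar>cmod (A $$ (i, i))\<bar> * \<bar>1\<bar>)"
    by (simp add: norm_sum)
  also have "\<dots> \<le> L2_set (\<lambda>i. cmod (A $$ (i, i))) {..<n} * L2_set (\<lambda>i. 1) {..<n}"
    by (rule L2_set_mult_ineq)
  also have "\<dots> \<le> L2_set (\<lambda>(i, j). cmod (A $$ (i, j))) ({..<n} \<times> {..<n}) * sqrt n"
  proof (rule mult_mono)
    have "(\<Sum>i<n. (cmod (A $$ (i, i)))\<^sup>2) = (\<Sum>(i, j)\<in>(\<lambda>i. (i, i)) ` {..<n}. (cmod (A $$ (i, j)))\<^sup>2)"
      by (subst sum.reindex) (auto simp: inj_on_def)
    also have "\<dots> \<le> (\<Sum>(i, j)\<in>{..<n} \<times> {..<n}. (cmod (A $$ (i, j)))\<^sup>2)"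
      by (rule sum_mono2) auto
    finally show "L2_set (\<lambda>i. cmod (A $$ (i, i))) {..<n} \<le>
        L2_set (\<lambda>(i, j). cmod (A $$ (i, j))) ({..<n} \<times> {..<n})"
      by (simp add: L2_set_def case_prod_unfold)
  qed (auto simp: L2_set_nonneg L2_set_def intro!: sum_nonneg)
  finally have "cmod (\<Sum>i<n. A $$ (i, i)) / n \<le>
      L2_set (\<lambda>(i, j). cmod (A $$ (i, j))) ({..<n} \<times> {..<n}) * (sqrt n / n)"
    by (simp add: divide_right_mono)
  also have "sqrt n / n = 1 / sqrt n"
    by (simp add: sqrt_divide_self_eq inverse_eq_divide)
  finally show ?thesis
    using A by (simp add: norm_tr_def norm2_L2_set[OF A] norm_divide case_prod_unfold)
qed

lemma norm_tr_minus:
  assumes "A \<in> carrier_mat n n" "B \<in> carrier_mat n n"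
  shows "norm_tr (A - B) = norm_tr A - norm_tr B"
  using assms by (simp add: norm_tr_def sum_subtractf diff_divide_distrib)

section \<open>Bounded sequences modulo null sequences\<close>

lemma bounded_seqs_simps:
  "x \<in> carrier (bounded_seqs n) \<longleftrightarrow>
     (\<forall>k. x k \<in> carrier_mat (n k) (n k)) \<and> (\<exists>C. \<forall>k. op_norm (x k) \<le> C)"
  "x \<otimes>\<^bsub>bounded_seqs n\<^esub> y = (\<lambda>k. x k * y k)"
  "\<one>\<^bsub>bounded_seqs n\<^esub> = (\<lambda>k. 1\<^sub>m (n k))"
  "\<zero>\<^bsub>bounded_seqs n\<^esub> = (\<lambda>k. 0\<^sub>m (n k) (n k))"
  "x \<oplus>\<^bsub>bounded_seqs n\<^esub> y = (\<lambda>k. x k + y k)"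
  by (simp_all add: bounded_seqs_def)

lemma bounded_seqs_add_closed:
  assumes "x \<in> carrier (bounded_seqs n)" "y \<in> carrier (bounded_seqs n)"
  shows "(\<lambda>k. x k + y k) \<in> carrier (bounded_seqs n)"
proof -
  obtain C D where "\<forall>k. op_norm (x k) \<le> C" "\<forall>k. op_norm (y k) \<le> D"
    using assms by (auto simp: bounded_seqs_simps)
  then have "op_norm (x k + y k) \<le> C + D" for k
    using assms op_norm_add[of "x k" "n k" "y k"]
    by (smt (verit, best) bounded_seqs_simps(1))
  then show ?thesis using assms by (auto simp: bounded_seqs_simps)
qed

lemma bounded_seqs_uminus_closed:
  assumes "x \<in> carrier (bounded_seqs n)"
  shows "(\<lambda>k. - x k) \<in> carrier (bounded_seqs n)"
  using assms order_trans[OF op_norm_uminus] by (fastforce simp: bounded_seqs_simps)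

lemma bounded_seqs_mult_closed:
  assumes "x \<in> carrier (bounded_seqs n)" "y \<in> carrier (bounded_seqs n)"
  shows "(\<lambda>k. x k * y k) \<in> carrier (bounded_seqs n)"
proof -
  obtain C D where CD: "\<forall>k. op_norm (x k) \<le> C" "\<forall>k. op_norm (y k) \<le> D"
    using assms by (auto simp: bounded_seqs_simps)
  have "op_norm (x k * y k) \<le> C * D" for k
  proof -
    have "op_norm (x k * y k) \<le> op_norm (x k) * op_norm (y k)"
      using assms by (intro op_norm_mult[of _ "n k"]) (auto simp: bounded_seqs_simps)
    also have "\<dots> \<le> C * D"
      using CD op_norm_nonneg by (intro mult_mono) (auto intro: order_trans)
    finally show ?thesis .
  qed
  moreover have "x k * y k \<in> carrier_mat (n k) (n k)" for k
    using assms by (intro mult_carrier_mat[of _ _ "n k"]) (auto simp: bounded_seqs_simps)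
  ultimately show ?thesis by (auto simp: bounded_seqs_simps)
qed

lemma bounded_seqs_const_closed:
  "(\<lambda>k. 0\<^sub>m (n k) (n k)) \<in> carrier (bounded_seqs n)"
  "(\<lambda>k. 1\<^sub>m (n k)) \<in> carrier (bounded_seqs n)"
proof -
  have "0\<^sub>m (n k) (n k) *\<^sub>v v = 0\<^sub>v (n k)" if "v \<in> carrier_vec (n k)" for k and v :: "complex Matrix.vec"
    using that by (intro eq_vecI) auto
  then have "op_norm (0\<^sub>m (n k) (n k)) \<le> 1" "op_norm (1\<^sub>m (n k)) \<le> 1" for k
    by (auto intro!: op_norm_le simp: vec_norm2_zero vec_norm2_nonneg)
  then show "(\<lambda>k. 0\<^sub>m (n k) (n k)) \<in> carrier (bounded_seqs n)"
    "(\<lambda>k. 1\<^sub>m (n k)) \<in> carrier (bounded_seqs n)"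
    by (auto simp: bounded_seqs_simps)
qed

lemma ring_bounded_seqs: "ring (bounded_seqs n)"
proof -
  note [simp] = bounded_seqs_simps(2-5)
  have dim: "x k \<in> carrier_mat (n k) (n k)" if "x \<in> carrier (bounded_seqs n)" for x k
    using that by (simp add: bounded_seqs_simps(1))
  show ?thesis
  proof (rule ringI)
    show "abelian_group (bounded_seqs n)"
    proof (rule abelian_groupI)
      fix x y z assume x: "x \<in> carrier (bounded_seqs n)" and y: "y \<in> carrier (bounded_seqs n)"
        and z: "z \<in> carrier (bounded_seqs n)"
      show "x \<oplus>\<^bsub>bounded_seqs n\<^esub> y \<oplus>\<^bsub>bounded_seqs n\<^esub> z =
          x \<oplus>\<^bsub>bounded_seqs n\<^esub> (y \<oplus>\<^bsub>bounded_seqs n\<^esub> z)"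
        using assoc_add_mat[OF dim[OF x] dim[OF y] dim[OF z]] by simp
      show "x \<oplus>\<^bsub>bounded_seqs n\<^esub> y = y \<oplus>\<^bsub>bounded_seqs n\<^esub> x"
        using comm_add_mat[OF dim[OF x] dim[OF y]] by simp
    next
      fix x assume x: "x \<in> carrier (bounded_seqs n)"
      show "\<zero>\<^bsub>bounded_seqs n\<^esub> \<oplus>\<^bsub>bounded_seqs n\<^esub> x = x"
        using left_add_zero_mat[OF dim[OF x]] by simp
      have "(\<lambda>k. - x k + x k) = (\<lambda>k. 0\<^sub>m (n k) (n k))"
        using uminus_l_inv_mat[OF dim[OF x]] by simp
      then show "\<exists>y\<in>carrier (bounded_seqs n). y \<oplus>\<^bsub>bounded_seqs n\<^esub> x = \<zero>\<^bsub>bounded_seqs n\<^esub>"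
        using bounded_seqs_uminus_closed[OF x] by auto
    qed (simp_all add: bounded_seqs_add_closed bounded_seqs_const_closed)
    show "monoid (bounded_seqs n)"
    proof (rule monoidI)
      fix x y z assume x: "x \<in> carrier (bounded_seqs n)" and y: "y \<in> carrier (bounded_seqs n)"
        and z: "z \<in> carrier (bounded_seqs n)"
      show "x \<otimes>\<^bsub>bounded_seqs n\<^esub> y \<otimes>\<^bsub>bounded_seqs n\<^esub> z =
          x \<otimes>\<^bsub>bounded_seqs n\<^esub> (y \<otimes>\<^bsub>bounded_seqs n\<^esub> z)"
        using assoc_mult_mat[OF dim[OF x] dim[OF y] dim[OF z]] by simp
    next
      fix x assume x: "x \<in> carrier (bounded_seqs n)"
      show "\<one>\<^bsub>bounded_seqs n\<^esub> \<otimes>\<^bsub>bounded_seqs n\<^esub> x = x" "x \<otimes>\<^bsub>bounded_seqs n\<^esub> \<one>\<^bsub>bounded_seqs n\<^esub> = x"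
        using left_mult_one_mat[OF dim[OF x]] right_mult_one_mat[OF dim[OF x]] by simp_all
    qed (simp_all add: bounded_seqs_mult_closed bounded_seqs_const_closed)
  next
    fix x y z assume x: "x \<in> carrier (bounded_seqs n)" and y: "y \<in> carrier (bounded_seqs n)"
      and z: "z \<in> carrier (bounded_seqs n)"
    show "(x \<oplus>\<^bsub>bounded_seqs n\<^esub> y) \<otimes>\<^bsub>bounded_seqs n\<^esub> z =
        x \<otimes>\<^bsub>bounded_seqs n\<^esub> z \<oplus>\<^bsub>bounded_seqs n\<^esub> y \<otimes>\<^bsub>bounded_seqs n\<^esub> z"
      using add_mult_distrib_mat[OF dim[OF x] dim[OF y] dim[OF z]] by simp
    show "z \<otimes>\<^bsub>bounded_seqs n\<^esub> (x \<oplus>\<^bsub>bounded_seqs n\<^esub> y) =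
        z \<otimes>\<^bsub>bounded_seqs n\<^esub> x \<oplus>\<^bsub>bounded_seqs n\<^esub> z \<otimes>\<^bsub>bounded_seqs n\<^esub> y"
      using mult_add_distrib_mat[OF dim[OF z] dim[OF x] dim[OF y]] by simp
  qed
qed

lemma bounded_seqs_uminus:
  assumes "x \<in> carrier (bounded_seqs n)"
  shows "\<ominus>\<^bsub>bounded_seqs n\<^esub> x = (\<lambda>k. - x k)"
proof -
  interpret ring "bounded_seqs n" by (rule ring_bounded_seqs)
  have "(\<lambda>k. - x k) \<oplus>\<^bsub>bounded_seqs n\<^esub> x = \<zero>\<^bsub>bounded_seqs n\<^esub>"
    using assms by (auto simp: bounded_seqs_simps uminus_l_inv_mat)
  then show ?thesis
    using minus_equality assms bounded_seqs_uminus_closed by blast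
qed

text \<open>Closure under multiplication is the estimate \<open>\<parallel>x a\<parallel>\<^sub>2 \<le> \<parallel>x\<parallel> \<parallel>a\<parallel>\<^sub>2\<close> and its mirror image, with the
operator norms of \<open>x\<close> bounded uniformly in the index.\<close>

lemma ideal_null_seqs: "ideal (null_seqs \<omega> n) (bounded_seqs n)"
proof (rule idealI)
  interpret ring "bounded_seqs n" by (rule ring_bounded_seqs)
  note car = bounded_seqs_simps(1)
  show "ring (bounded_seqs n)" by (rule ring_bounded_seqs)
  show "subgroup (null_seqs \<omega> n) (add_monoid (bounded_seqs n))"
  proof (rule add.subgroupI)
    have "norm2 (0\<^sub>m (n k) (n k)) = 0" for k
      by (auto simp: norm2_L2_set[of _ "n k"] L2_set_eq_0_iff)
    then have "(\<lambda>k. 0\<^sub>m (n k) (n k)) \<in> null_seqs \<omega> n"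
      by (simp add: null_seqs_def bounded_seqs_const_closed)
    then show "null_seqs \<omega> n \<noteq> {}" by blast
  next
    fix x assume x: "x \<in> null_seqs \<omega> n"
    then have "x \<in> carrier (bounded_seqs n)" by (simp add: null_seqs_def)
    moreover from this have "norm2 (- x k) = norm2 (x k)" for k
      by (simp add: car norm2_uminus[of _ "n k"])
    ultimately show "\<ominus>\<^bsub>bounded_seqs n\<^esub> x \<in> null_seqs \<omega> n"
      using x by (simp add: null_seqs_def bounded_seqs_uminus bounded_seqs_uminus_closed)
  next
    fix x y assume xy: "x \<in> null_seqs \<omega> n" "y \<in> null_seqs \<omega> n"
    have "((\<lambda>k. norm2 (x k + y k)) \<longlongrightarrow> 0) \<omega>"
    proof (rule Lim_null_comparison[where g = "\<lambda>k. norm2 (x k) + norm2 (y k)"])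
      show "\<forall>\<^sub>F k in \<omega>. norm (norm2 (x k + y k)) \<le> norm2 (x k) + norm2 (y k)"
      proof (intro always_eventually allI)
        fix k
        have "x k \<in> carrier_mat (n k) (n k)" "y k \<in> carrier_mat (n k) (n k)"
          using xy by (simp_all add: null_seqs_def car)
        then show "norm (norm2 (x k + y k)) \<le> norm2 (x k) + norm2 (y k)"
          using norm2_add[of "x k" "n k" "y k"] norm2_nonneg[of "x k + y k" "n k"] by simp
      qed
      show "((\<lambda>k. norm2 (x k) + norm2 (y k)) \<longlongrightarrow> 0) \<omega>"
        using xy tendsto_add[of "\<lambda>k. norm2 (x k)" 0 \<omega> "\<lambda>k. norm2 (y k)" 0] by (simp add: null_seqs_def)
    qed
    then show "x \<oplus>\<^bsub>bounded_seqs n\<^esub> y \<in> null_seqs \<omega> n"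
      using xy by (simp add: null_seqs_def bounded_seqs_add_closed bounded_seqs_simps(5))
  qed (auto simp: null_seqs_def)
next
  note car = bounded_seqs_simps(1)
  fix a x assume a: "a \<in> null_seqs \<omega> n" and x: "x \<in> carrier (bounded_seqs n)"
  then have a': "a \<in> carrier (bounded_seqs n)" by (simp add: null_seqs_def)
  have dim: "x k \<in> carrier_mat (n k) (n k)" "a k \<in> carrier_mat (n k) (n k)" for k
    using x a' by (simp_all add: car)
  obtain C where C: "\<And>k. op_norm (x k) \<le> C" using x by (auto simp: car)
  have l: "norm2 (x k * a k) \<le> C * norm2 (a k)" for k
    by (rule order_trans[OF norm2_mult_left[OF dim]])
       (simp add: mult_right_mono C norm2_nonneg[OF dim(2)])
  have r: "norm2 (a k * x k) \<le> C * norm2 (a k)" for k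
    by (rule order_trans[OF norm2_mult_right[OF dim(2,1)]])
       (simp add: mult.commute[of "norm2 _"] mult_right_mono C norm2_nonneg[OF dim(2)])
  have "((\<lambda>k. C * norm2 (a k)) \<longlongrightarrow> 0) \<omega>"
    using a tendsto_mult_left[of "\<lambda>k. norm2 (a k)" 0 \<omega> C] by (simp add: null_seqs_def)
  then have "((\<lambda>k. norm2 (x k * a k)) \<longlongrightarrow> 0) \<omega>" "((\<lambda>k. norm2 (a k * x k)) \<longlongrightarrow> 0) \<omega>"
    using l r norm2_nonneg[OF mult_carrier_mat[OF dim]] norm2_nonneg[OF mult_carrier_mat[OF dim(2,1)]]
    by (auto intro!: Lim_null_comparison[where g = "\<lambda>k. C * norm2 (a k)"] always_eventually simp: abs_of_nonneg)
  then show "x \<otimes>\<^bsub>bounded_seqs n\<^esub> a \<in> null_seqs \<omega> n" "a \<otimes>\<^bsub>bounded_seqs n\<^esub> x \<in> null_seqs \<omega> n"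
    using x a' by (simp_all add: null_seqs_def bounded_seqs_mult_closed bounded_seqs_simps(2))
qed

lemma ultra_class_eq_iff:
  assumes "x \<in> carrier (bounded_seqs n)" "y \<in> carrier (bounded_seqs n)"
  shows "ultra_class \<omega> n x = ultra_class \<omega> n y \<longleftrightarrow> ((\<lambda>k. norm2 (x k - y k)) \<longlongrightarrow> 0) \<omega>"
proof -
  interpret ring "bounded_seqs n" by (rule ring_bounded_seqs)
  have "x \<ominus>\<^bsub>bounded_seqs n\<^esub> y = (\<lambda>k. x k + - y k)"
    using assms by (simp add: a_minus_def bounded_seqs_uminus bounded_seqs_simps(5))
  also have "\<dots> = (\<lambda>k. x k - y k)"
  proof
    fix k
    show "x k + - y k = x k - y k"
      using assms minus_add_uminus_mat[of "x k" "n k" "n k" "y k"] by (simp add: bounded_seqs_simps(1))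
  qed
  finally have "x \<ominus>\<^bsub>bounded_seqs n\<^esub> y \<in> null_seqs \<omega> n \<longleftrightarrow> ((\<lambda>k. norm2 (x k - y k)) \<longlongrightarrow> 0) \<omega>"
    using minus_closed[OF assms] by (simp add: null_seqs_def)
  then show ?thesis
    using quotient_eq_iff_same_a_r_cos[OF ideal_null_seqs assms] by (simp add: ultra_class_def)
qed

lemma mem_ultra_class_iff:
  assumes "x \<in> carrier (bounded_seqs n)"
  shows "y \<in> ultra_class \<omega> n x \<longleftrightarrow>
    y \<in> carrier (bounded_seqs n) \<and> ((\<lambda>k. norm2 (x k - y k)) \<longlongrightarrow> 0) \<omega>"
proof -
  interpret ideal "null_seqs \<omega> n" "bounded_seqs n" by (rule ideal_null_seqs)
  have "y \<in> ultra_class \<omega> n x \<longleftrightarrow> y \<in> carrier (bounded_seqs n) \<and> ultra_class \<omega> n x = ultra_class \<omega> n y"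
    using assms a_repr_independence a_rcos_self a_elemrcos_carrier unfolding ultra_class_def
    by (metis a_subgroup)
  then show ?thesis using ultra_class_eq_iff assms by blast
qed

lemma ultra_class_mult:
  assumes "x \<in> carrier (bounded_seqs n)" "y \<in> carrier (bounded_seqs n)"
  shows "ultra_class \<omega> n x \<otimes>\<^bsub>mat_ultra \<omega> n\<^esub> ultra_class \<omega> n y = ultra_class \<omega> n (\<lambda>k. x k * y k)"
  using ideal.rcoset_mult_add[OF ideal_null_seqs assms]
  by (simp add: mat_ultra_def FactRing_def ultra_class_def bounded_seqs_simps(2))

text \<open>The adjoint is an isometric involution for both norms, so it maps each coset onto the coset of
the adjoint, not merely into it.\<close>

lemma ultra_adjoint_class:
  assumes x: "x \<in> carrier (bounded_seqs n)"
  shows "ultra_adjoint (ultra_class \<omega> n x) = ultra_class \<omega> n (\<lambda>k. mat_adjoint (x k))"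
proof -
  have closed: "(\<lambda>k. mat_adjoint (y k)) \<in> carrier (bounded_seqs n)"
    if "y \<in> carrier (bounded_seqs n)" for y
    using that order_trans[OF op_norm_adjoint] mat_adjoint_index(1)
    unfolding bounded_seqs_simps(1) by meson
  have diff: "norm2 (mat_adjoint (y k) - mat_adjoint (z k)) = norm2 (y k - z k)"
    if "y \<in> carrier (bounded_seqs n)" "z \<in> carrier (bounded_seqs n)" for y z k
  proof -
    have yz: "y k \<in> carrier_mat (n k) (n k)" "z k \<in> carrier_mat (n k) (n k)"
      using that by (auto simp: bounded_seqs_simps(1))
    note a = mat_adjoint_index[OF yz(1)] mat_adjoint_index[OF yz(2)]
      mat_adjoint_index[OF minus_carrier_mat[OF yz(2), where A = "y k"]]
    have "mat_adjoint (y k) - mat_adjoint (z k) = mat_adjoint (y k - z k)"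
      using yz a by (intro eq_matI) (auto dest: carrier_matD)
    then show ?thesis using norm2_adjoint[OF minus_carrier_mat[OF yz(2)]] by simp
  qed
  have sub: "(\<lambda>k. mat_adjoint (z k)) \<in> ultra_class \<omega> n (\<lambda>k. mat_adjoint (y k))"
    if "z \<in> ultra_class \<omega> n y" "y \<in> carrier (bounded_seqs n)" for y z
    using that diff closed by (simp add: mem_ultra_class_iff)
  have invol: "(\<lambda>k. mat_adjoint (mat_adjoint (y k))) = y" if "y \<in> carrier (bounded_seqs n)" for y
    using that mat_adjoint_adjoint by (auto simp: bounded_seqs_simps(1))
  have "z \<in> ultra_adjoint (ultra_class \<omega> n x)" if z: "z \<in> ultra_class \<omega> n (\<lambda>k. mat_adjoint (x k))" for z
  proof -
    have "z \<in> carrier (bounded_seqs n)" using z closed[OF x] by (simp add: mem_ultra_class_iff)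
    moreover have "(\<lambda>k. mat_adjoint (z k)) \<in> ultra_class \<omega> n x"
      using sub[OF z closed[OF x]] invol[OF x] by simp
    ultimately show ?thesis
      unfolding ultra_adjoint_def using invol[of z]
      by (intro image_eqI[of z _ "\<lambda>k. mat_adjoint (z k)"]) simp_all
  qed
  then show ?thesis using sub x unfolding ultra_adjoint_def by auto
qed

section \<open>Permutation matrices and the normalized Hamming distance\<close>

definition perm_mat :: "nat \<Rightarrow> (nat \<Rightarrow> nat) \<Rightarrow> complex mat" where
  "perm_mat n s = Matrix.mat n n (\<lambda>(i, j). if i = s j then 1 else 0)"

definition proportion :: "nat \<Rightarrow> (nat \<Rightarrow> bool) \<Rightarrow> real" where
  "proportion n P = real (card {j. j < n \<and> P j}) / real n"

lemma perm_mat_carrier [simp]: "perm_mat n s \<in> carrier_mat n n"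
  by (simp add: perm_mat_def)

lemma perm_mat_index: "i < n \<Longrightarrow> j < n \<Longrightarrow> perm_mat n s $$ (i, j) = (if i = s j then 1 else 0)"
  by (simp add: perm_mat_def)

lemma perm_mat_dim [simp]: "dim_row (perm_mat n s) = n" "dim_col (perm_mat n s) = n"
  by (simp_all add: perm_mat_def)

lemma op_norm_perm_mat:
  assumes s: "s permutes {..<n}"
  shows "op_norm (perm_mat n s) \<le> 1"
proof (rule op_norm_le)
  fix v :: "complex Matrix.vec" assume "v \<in> carrier_vec (dim_col (perm_mat n s))"
  then have v: "v \<in> carrier_vec n" by simp
  have "vec_index (perm_mat n s *\<^sub>v v) (s j) = vec_index v j" if j: "j < n" for j
  proof -
    have sj: "s j < n" using s j permutes_in_image by fastforce
    have "vec_index (perm_mat n s *\<^sub>v v) (s j) = (\<Sum>l<n. (if s j = s l then 1 else 0) * vec_index v l)"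
      using sj v by (auto simp: scalar_prod_def perm_mat_index lessThan_atLeast0 intro!: sum.cong)
    also have "\<dots> = (\<Sum>l<n. if j = l then vec_index v l else 0)"
      using permutes_inj[OF s] by (intro sum.cong) (auto dest: injD)
    finally show ?thesis using j by simp
  qed
  then have "(\<Sum>j<n. (cmod (vec_index (perm_mat n s *\<^sub>v v) (s j)))\<^sup>2) = (\<Sum>j<n. (cmod (vec_index v j))\<^sup>2)"
    by simp
  moreover have "(\<Sum>j<n. (cmod (vec_index (perm_mat n s *\<^sub>v v) j))\<^sup>2) =
      (\<Sum>j<n. (cmod (vec_index (perm_mat n s *\<^sub>v v) (s j)))\<^sup>2)"
    using sum.permute[OF s, of "\<lambda>j. (cmod (vec_index (perm_mat n s *\<^sub>v v) j))\<^sup>2"]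
    by (simp only: o_def)
  ultimately show "vec_norm2 (perm_mat n s *\<^sub>v v) \<le> 1 * vec_norm2 v"
    using v by (simp add: vec_norm2_L2_set L2_set_def)
qed simp

lemma perm_mat_mult:
  assumes "t permutes {..<n}"
  shows "perm_mat n s * perm_mat n t = perm_mat n (s \<circ> t)"
proof (rule eq_matI)
  fix i j assume "i < dim_row (perm_mat n (s \<circ> t))" "j < dim_col (perm_mat n (s \<circ> t))"
  then have i: "i < n" and j: "j < n" by simp_all
  have tj: "t j < n" using assms j permutes_in_image by fastforce
  have "(perm_mat n s * perm_mat n t) $$ (i, j) = (\<Sum>l<n. (if i = s l then 1 else 0) * (if l = t j then 1 else 0))"
    using i j by (auto simp: scalar_prod_def perm_mat_index lessThan_atLeast0 intro!: sum.cong)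
  also have "\<dots> = (\<Sum>l<n. if l = t j then (if i = s l then 1 else 0) else 0)"
    by (intro sum.cong) auto
  also have "\<dots> = perm_mat n (s \<circ> t) $$ (i, j)"
    using i j tj by (simp add: perm_mat_index)
  finally show "(perm_mat n s * perm_mat n t) $$ (i, j) = perm_mat n (s \<circ> t) $$ (i, j)" .
qed simp_all

lemma perm_mat_adjoint:
  assumes s: "s permutes {..<n}"
  shows "mat_adjoint (perm_mat n s) = perm_mat n (inv_into UNIV s)"
proof (rule eq_matI)
  note a = mat_adjoint_index[OF perm_mat_carrier[of n s]]
  show "dim_row (mat_adjoint (perm_mat n s)) = dim_row (perm_mat n (inv_into UNIV s))"
    "dim_col (mat_adjoint (perm_mat n s)) = dim_col (perm_mat n (inv_into UNIV s))"
    using a(1) by auto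
  fix i j assume "i < dim_row (perm_mat n (inv_into UNIV s))" "j < dim_col (perm_mat n (inv_into UNIV s))"
  then show "mat_adjoint (perm_mat n s) $$ (i, j) = perm_mat n (inv_into UNIV s) $$ (i, j)"
    using a(2) permutes_inverses[OF s] by (auto simp: perm_mat_index)
qed

lemma norm_tr_perm_mat: "norm_tr (perm_mat n s) = complex_of_real (proportion n (\<lambda>j. s j = j))"
proof -
  have "(\<Sum>i<n. perm_mat n s $$ (i, i)) = (\<Sum>i<n. if s i = i then 1 else 0)"
    by (intro sum.cong) (auto simp: perm_mat_index)
  also have "\<dots> = of_nat (card {j. j < n \<and> s j = j})"
    by (simp add: sum.If_cases Int_def)
  finally show ?thesis by (simp add: norm_tr_def proportion_def)
qed

text \<open>Each column where the permutations disagree contains exactly two entries of modulus \<open>1\<close>, and the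
other columns vanish.\<close>

lemma norm2_perm_mat_diff:
  assumes s: "s permutes {..<n}" and t: "t permutes {..<n}"
  shows "norm2 (perm_mat n s - perm_mat n t) = sqrt (2 * proportion n (\<lambda>j. s j \<noteq> t j))"
proof -
  have col: "(\<Sum>i<n. (cmod ((perm_mat n s - perm_mat n t) $$ (i, j)))\<^sup>2) = (if s j \<noteq> t j then 2 else 0)"
    if j: "j < n" for j
  proof -
    have lt: "s j < n" "t j < n" using s t j permutes_in_image by fastforce+
    have "(\<Sum>i<n. (cmod ((perm_mat n s - perm_mat n t) $$ (i, j)))\<^sup>2) =
      (\<Sum>i<n. if s j \<noteq> t j then (if i = s j then 1 else 0) + (if i = t j then 1 else 0) else 0)"
      using j by (intro sum.cong) (auto simp: perm_mat_index)
    then show ?thesis using lt by (auto simp: sum.distrib)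
  qed
  have "(\<Sum>(i, j)\<in>{..<n} \<times> {..<n}. (cmod ((perm_mat n s - perm_mat n t) $$ (i, j)))\<^sup>2) =
      (\<Sum>j<n. if s j \<noteq> t j then 2 else 0)"
    unfolding sum.cartesian_product[symmetric] by (subst sum.swap) (intro sum.cong col, auto)
  also have "\<dots> = 2 * real (card {j. j < n \<and> s j \<noteq> t j})"
    by (simp add: sum.If_cases Int_def)
  finally have "(\<Sum>(i, j)\<in>{..<n} \<times> {..<n}. (cmod ((perm_mat n s - perm_mat n t) $$ (i, j)))\<^sup>2) =
     2 * real (card {j. j < n \<and> s j \<noteq> t j})" .
  then show ?thesis
    unfolding norm2_L2_set[OF minus_carrier_mat[OF perm_mat_carrier]] L2_set_def proportion_def
    by (simp add: case_prod_unfold flip: real_sqrt_divide)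
qed

lemma proportion_nonneg: "proportion n P \<ge> 0"
  by (simp add: proportion_def)

lemma proportion_mono:
  assumes "\<And>j. j < n \<Longrightarrow> P j \<Longrightarrow> Q j"
  shows "proportion n P \<le> proportion n Q"
  unfolding proportion_def
  by (intro divide_right_mono of_nat_mono card_mono) (use assms in auto)

lemma proportion_disj_le: "proportion n (\<lambda>j. P j \<or> Q j) \<le> proportion n P + proportion n Q"
proof -
  have "card {j. j < n \<and> (P j \<or> Q j)} = card ({j. j < n \<and> P j} \<union> {j. j < n \<and> Q j})"
    by (rule arg_cong[where f = card]) auto
  also have "\<dots> \<le> card {j. j < n \<and> P j} + card {j. j < n \<and> Q j}"
    by (rule card_Un_le)
  finally have "real (card {j. j < n \<and> (P j \<or> Q j)}) \<le> real (card {j. j < n \<and> P j}) + real (card {j. j < n \<and> Q j})"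
    by linarith
  then show ?thesis
    by (simp add: proportion_def divide_right_mono flip: add_divide_distrib)
qed

text \<open>Invariance of the Hamming distance under composition from the right rests on this.\<close>

lemma proportion_permute:
  assumes s: "s permutes {..<n}"
  shows "proportion n (\<lambda>j. P (s j)) = proportion n P"
proof -
  have "s ` {j. j < n \<and> P (s j)} = {j. j < n \<and> P j}"
  proof safe
    fix j assume "j < n" then show "s j < n" using s permutes_in_image by fastforce
  next
    fix j assume j: "j < n" "P j"
    have "s (inv_into UNIV s j) = j" using permutes_inverses(1)[OF s] .
    moreover from this have "inv_into UNIV s j < n"
      using j permutes_in_image[OF s, of "inv_into UNIV s j"] by simp
    ultimately show "j \<in> s ` {j. j < n \<and> P (s j)}"
      using j by (intro image_eqI[of _ _ "inv_into UNIV s j"]) auto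
  qed
  then have "card {j. j < n \<and> P j} = card {j. j < n \<and> P (s j)}"
    using card_image[OF inj_on_subset[OF permutes_inj[OF s] subset_UNIV]] by metis
  then show ?thesis by (simp add: proportion_def)
qed

definition perm_seq :: "(nat \<Rightarrow> nat) \<Rightarrow> (nat \<Rightarrow> nat \<Rightarrow> nat) \<Rightarrow> bool" where
  "perm_seq n s \<longleftrightarrow> (\<forall>k. s k permutes {..<n k})"

text \<open>Equality in the ultraproduct, expressed by permutations: the normalized Hamming distance vanishes
along the filter.\<close>

definition near :: "nat filter \<Rightarrow> (nat \<Rightarrow> nat) \<Rightarrow> (nat \<Rightarrow> nat \<Rightarrow> nat) \<Rightarrow> (nat \<Rightarrow> nat \<Rightarrow> nat) \<Rightarrow> bool" where
  "near \<omega> n s t \<longleftrightarrow> ((\<lambda>k. proportion (n k) (\<lambda>j. s k j \<noteq> t k j)) \<longlongrightarrow> 0) \<omega>"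

lemma tendsto_zero_nonneg_le:
  fixes f g :: "nat \<Rightarrow> real"
  assumes "(g \<longlongrightarrow> 0) F" "\<And>k. 0 \<le> f k" "\<And>k. f k \<le> g k"
  shows "(f \<longlongrightarrow> 0) F"
  by (rule Lim_null_comparison[OF _ assms(1)]) (use assms(2,3) in simp)

lemma near_refl [simp]: "near \<omega> n s s"
  by (simp add: near_def proportion_def)

lemma near_sym: "near \<omega> n s t \<longleftrightarrow> near \<omega> n t s"
  by (simp add: near_def eq_commute)

lemma near_trans:
  assumes "near \<omega> n s t" "near \<omega> n t u"
  shows "near \<omega> n s u"
  unfolding near_def
proof (rule tendsto_zero_nonneg_le)
  show "((\<lambda>k. proportion (n k) (\<lambda>j. s k j \<noteq> t k j) + proportion (n k) (\<lambda>j. t k j \<noteq> u k j)) \<longlongrightarrow> 0) \<omega>"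
    using tendsto_add[OF assms[unfolded near_def]] by simp
  show "proportion (n k) (\<lambda>j. s k j \<noteq> u k j) \<le>
      proportion (n k) (\<lambda>j. s k j \<noteq> t k j) + proportion (n k) (\<lambda>j. t k j \<noteq> u k j)" for k
    by (rule order_trans[OF proportion_mono proportion_disj_le]) auto
qed (rule proportion_nonneg)

lemma near_comp:
  assumes s: "near \<omega> n s s'" and t: "near \<omega> n t t'" and p: "perm_seq n t"
  shows "near \<omega> n (\<lambda>k. s k \<circ> t k) (\<lambda>k. s' k \<circ> t' k)"
  unfolding near_def
proof (rule tendsto_zero_nonneg_le)
  show "((\<lambda>k. proportion (n k) (\<lambda>j. s k j \<noteq> s' k j) + proportion (n k) (\<lambda>j. t k j \<noteq> t' k j)) \<longlongrightarrow> 0) \<omega>"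
    using tendsto_add[OF s[unfolded near_def] t[unfolded near_def]] by simp
  show "proportion (n k) (\<lambda>j. (s k \<circ> t k) j \<noteq> (s' k \<circ> t' k) j) \<le>
      proportion (n k) (\<lambda>j. s k j \<noteq> s' k j) + proportion (n k) (\<lambda>j. t k j \<noteq> t' k j)" for k
  proof -
    have "t k permutes {..<n k}" using p by (simp add: perm_seq_def)
    note proportion_permute[OF this, of "\<lambda>j. s k j \<noteq> s' k j", symmetric]
    then show ?thesis
      by (simp only:) (rule order_trans[OF proportion_mono proportion_disj_le], auto)
  qed
qed (rule proportion_nonneg)

section \<open>Amplifications of permutations\<close>

text \<open>A point \<open>p < n * r\<close> stands for the pair \<open>(p div r, p mod r)\<close>, as in \<^const>\<open>kronecker\<close>; the
permutation acts on the first coordinate. A permutation that fixes all points from \<open>n\<close> on yields one that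
fixes all points from \<open>n * r\<close> on, so no case distinction is needed.\<close>

definition amp :: "nat \<Rightarrow> (nat \<Rightarrow> nat) \<Rightarrow> nat \<Rightarrow> nat" where
  "amp r s p = s (p div r) * r + p mod r"

lemma amp_comp: "r > 0 \<Longrightarrow> amp r (s \<circ> t) = amp r s \<circ> amp r t"
  by (auto simp: amp_def)

lemma amp_id [simp]: "amp r (\<lambda>j. j) = (\<lambda>j. j)"
  by (auto simp: amp_def)

lemma amp_1 [simp]: "amp (Suc 0) s = s"
  by (auto simp: amp_def)

text \<open>An equality of functions, not only up to conjugation: both sides read off the quotient by \<open>q * r\<close>.
This is what allows one to compare amplifications of different orders without further conjugating.\<close>

lemma amp_amp: "amp r (amp q s) = amp (q * r) s"
proof
  fix p
  have "p div (q * r) = p div r div q" by (metis div_mult2_eq mult.commute)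
  moreover have "p mod (q * r) = r * (p div r mod q) + p mod r"
    by (metis mod_mult2_eq mult.commute)
  ultimately show "amp r (amp q s) p = amp (q * r) s p"
    by (simp add: amp_def algebra_simps)
qed

text \<open>Amplifications and direct sums are functorial, so the inverse of their value is their value at the
inverse permutations; this turns functoriality into being a permutation.\<close>

lemma permutes_if_inverse:
  assumes "f \<circ> g = (\<lambda>x. x)" "g \<circ> f = (\<lambda>x. x)" "\<And>x. x \<notin> S \<Longrightarrow> f x = x"
  shows "f permutes S"
  unfolding permutes_def
proof (intro conjI allI impI ex1I)
  show "f (g y) = y" for y using assms(1) by (simp add: fun_eq_iff)
  show "x = g y" if "f x = y" for x y using assms(2) that by (auto simp: fun_eq_iff)
qed (rule assms(3))

lemma amp_less:
  assumes "r > 0" "q < n" "b < r"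
  shows "q * r + b < n * (r :: nat)"
proof -
  have "q * r + b < Suc q * r" using assms by simp
  also have "\<dots> \<le> n * r" using assms by (intro mult_le_mono1) simp
  finally show ?thesis .
qed

lemma amp_permutes:
  assumes r: "r > 0" and s: "s permutes {..<n}"
  shows "amp r s permutes {..<n * r}"
proof (rule permutes_if_inverse[where g = "amp r (inv_into UNIV s)"])
  have "s \<circ> inv_into UNIV s = (\<lambda>j. j)" "inv_into UNIV s \<circ> s = (\<lambda>j. j)"
    using permutes_inverses[OF s] by auto
  then show "amp r s \<circ> amp r (inv_into UNIV s) = (\<lambda>j. j)"
    "amp r (inv_into UNIV s) \<circ> amp r s = (\<lambda>j. j)"
    by (simp_all add: amp_comp[OF r, symmetric])
  show "amp r s p = p" if "p \<notin> {..<n * r}" for p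
  proof -
    have "n \<le> p div r" using that r by (simp add: less_eq_div_iff_mult_less_eq)
    then show ?thesis using permutes_not_in[OF s, of "p div r"] by (simp add: amp_def)
  qed
qed

lemma card_div_mod:
  "card {p. p < n * r \<and> P (p div r) \<and> Q (p mod r)} = card {j. j < n \<and> P j} * card {b. b < (r :: nat) \<and> Q b}"
proof (cases "r = 0")
  case False
  then have "bij_betw (\<lambda>(j, b). j * r + b) ({j. j < n \<and> P j} \<times> {b. b < r \<and> Q b})
      {p. p < n * r \<and> P (p div r) \<and> Q (p mod r)}"
    by (intro bij_betw_byWitness[where f' = "\<lambda>p. (p div r, p mod r)"])
       (auto simp: amp_less less_mult_imp_div_less)
  from bij_betw_same_card[OF this] show ?thesis by (simp add: card_cartesian_product)
qed simp

lemma proportion_amp: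
  assumes r: "r > 0"
  shows "proportion (n * r) (\<lambda>p. P (p div r)) = proportion n P"
  using card_div_mod[of n r P "\<lambda>_. True"] r by (simp add: proportion_def)

lemma amp_eq_iff: "r > 0 \<Longrightarrow> amp r s p = amp r t p \<longleftrightarrow> s (p div r) = t (p div r)"
  by (simp add: amp_def)

lemma amp_fixed_iff: "r > 0 \<Longrightarrow> amp r s p = p \<longleftrightarrow> s (p div r) = p div r"
  using amp_eq_iff[of r s p "\<lambda>j. j"] by simp

lemma kronecker_perm_mat:
  assumes r: "r > 0" and s: "s permutes {..<n}"
  shows "kronecker (perm_mat n s) (1\<^sub>m r) = perm_mat (n * r) (amp r s)"
proof (rule eq_matI)
  fix i j assume "i < dim_row (perm_mat (n * r) (amp r s))" "j < dim_col (perm_mat (n * r) (amp r s))"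
  then have i: "i < n * r" and j: "j < n * r" by simp_all
  have "i = s (j div r) * r + j mod r \<longleftrightarrow> i div r = s (j div r) \<and> i mod r = j mod r"
    using r by (metis add.commute div_mult_mod_eq div_mult_self3 mod_div_trivial mod_mod_trivial
        mod_mult_self3 add_cancel_right_left less_not_refl2)
  then show "kronecker (perm_mat n s) (1\<^sub>m r) $$ (i, j) = perm_mat (n * r) (amp r s) $$ (i, j)"
    using i j r by (simp add: kronecker_def perm_mat_index amp_def less_mult_imp_div_less)
qed (simp_all add: kronecker_def)

section \<open>Direct sums of permutations\<close>

text \<open>The first point of the \<open>i\<close>-th block when blocks of sizes \<open>d 1, d 2, \<dots>\<close> are laid out consecutively.\<close>

definition offset :: "(nat \<Rightarrow> nat) \<Rightarrow> nat \<Rightarrow> nat" where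
  "offset d i = (\<Sum>j=1..<i. d j)"

text \<open>The recursion splits off the last block, matching the value of \<^const>\<open>diag_block_mat\<close> on a list extended at its end.
Beyond the last block the last permutation is applied to the shifted point and fixes it.\<close>

fun dirsum :: "nat \<Rightarrow> (nat \<Rightarrow> nat) \<Rightarrow> (nat \<Rightarrow> nat \<Rightarrow> nat) \<Rightarrow> nat \<Rightarrow> nat" where
  "dirsum 0 d s p = p"
| "dirsum (Suc n) d s p = (if p < offset d (Suc n) then dirsum n d s p
     else offset d (Suc n) + s (Suc n) (p - offset d (Suc n)))"

lemma offset_Suc: "i \<ge> 1 \<Longrightarrow> offset d (Suc i) = offset d i + d i"
  by (simp add: offset_def)

lemma sum_eq_offset: "(\<Sum>i=1..n. d i) = offset d (Suc n)"
  by (simp add: offset_def atLeastLessThanSuc_atLeastAtMost)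

lemma offset_mono: "i \<le> j \<Longrightarrow> offset d i \<le> offset d j"
  unfolding offset_def by (intro sum_mono2) auto

lemma offset_block_less: "1 \<le> i \<Longrightarrow> i < j \<Longrightarrow> q < d i \<Longrightarrow> offset d i + q < offset d j"
  using offset_mono[of "Suc i" j d] offset_Suc[of i d] by simp

text \<open>Direct sums of permutations act on the second of the coordinates \<open>(i, q)\<close> given by this bijection, so
identities and counts are verified block by block.\<close>

lemma bij_betw_blocks:
  "bij_betw (\<lambda>(i, q). offset d i + q) (SIGMA i:{1..n}. {..<d i}) {..<\<Sum>i=1..n. d i}"
  unfolding bij_betw_def
proof (intro conjI)
  show "inj_on (\<lambda>(i, q). offset d i + q) (SIGMA i:{1..n}. {..<d i})"
  proof (rule inj_onI, clarify)
    fix i q j b assume *: "i \<in> {1..n}" "q < d i" "j \<in> {1..n}" "b < d j" "offset d i + q = offset d j + b"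
    have "i = j"
      using * offset_block_less[of i j q d] offset_block_less[of j i b d]
      by (cases i j rule: linorder_cases) auto
    then show "i = j \<and> q = b" using * by simp
  qed
  show "(\<lambda>(i, q). offset d i + q) ` (SIGMA i:{1..n}. {..<d i}) = {..<\<Sum>i=1..n. d i}"
  proof (induction n)
    case (Suc n)
    have "(\<lambda>(i, q). offset d i + q) ` (SIGMA i:{1..Suc n}. {..<d i}) =
        (\<lambda>(i, q). offset d i + q) ` (SIGMA i:{1..n}. {..<d i}) \<union> (\<lambda>q. offset d (Suc n) + q) ` {..<d (Suc n)}"
      by (auto simp: atLeastAtMostSuc_conv image_iff)
    also have "\<dots> = {..<offset d (Suc n)} \<union> {offset d (Suc n)..<offset d (Suc n) + d (Suc n)}"
      unfolding Suc.IH sum_eq_offset by (simp add: image_add_atLeastLessThan lessThan_atLeast0 add.commute)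
    also have "\<dots> = {..<\<Sum>i=1..Suc n. d i}"
      unfolding sum_eq_offset using offset_Suc[of "Suc n" d] by auto
    finally show ?case .
  qed auto
qed

lemma block_cases:
  assumes "p < (\<Sum>i=1..n. d i)"
  obtains i q where "i \<in> {1..n}" "q < d i" "p = offset d i + q"
proof -
  have "p \<in> (\<lambda>(i, q). offset d i + q) ` (SIGMA i:{1..n}. {..<d i})"
    using assms bij_betw_imp_surj_on[OF bij_betw_blocks[of d n]] by blast
  then show ?thesis using that by auto
qed

lemma block_less_sum: "i \<in> {1..n} \<Longrightarrow> q < d i \<Longrightarrow> offset d i + q < (\<Sum>i=1..n. d i)"
  unfolding sum_eq_offset by (rule offset_block_less) auto

lemma dirsum_block: "i \<in> {1..n} \<Longrightarrow> q < d i \<Longrightarrow> dirsum n d s (offset d i + q) = offset d i + s i q"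
proof (induction n)
  case (Suc n)
  then show ?case
    using offset_block_less[of i "Suc n" q d] by (cases "i = Suc n") auto
qed simp

lemma dirsum_outside:
  assumes "\<And>i. i \<in> {1..n} \<Longrightarrow> s i permutes {..<d i}" "p \<ge> (\<Sum>i=1..n. d i)"
  shows "dirsum n d s p = p"
  using assms
proof (induction n)
  case (Suc n)
  have "p \<ge> offset d (Suc n) + d (Suc n)"
    using Suc.prems(2) unfolding sum_eq_offset by (simp add: offset_Suc)
  then show ?case
    using permutes_not_in[OF Suc.prems(1)[of "Suc n"], of "p - offset d (Suc n)"] by simp
qed simp

lemma dirsum_comp:
  assumes s: "\<And>i. i \<in> {1..n} \<Longrightarrow> s i permutes {..<d i}"
    and t: "\<And>i. i \<in> {1..n} \<Longrightarrow> t i permutes {..<d i}"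
  shows "dirsum n d (\<lambda>i. s i \<circ> t i) = dirsum n d s \<circ> dirsum n d t"
proof
  fix p
  show "dirsum n d (\<lambda>i. s i \<circ> t i) p = (dirsum n d s \<circ> dirsum n d t) p"
  proof (cases "p < (\<Sum>i=1..n. d i)")
    case True
    then obtain i q where iq: "i \<in> {1..n}" "q < d i" "p = offset d i + q" by (rule block_cases)
    then have "t i q < d i" using t[of i] permutes_in_image by fastforce
    then show ?thesis using iq by (simp add: dirsum_block)
  next
    case False
    then have "p \<ge> (\<Sum>i=1..n. d i)" by simp
    moreover have "(s i \<circ> t i) permutes {..<d i}" if "i \<in> {1..n}" for i
      using s t that permutes_compose by blast
    ultimately show ?thesis
      using dirsum_outside[of n s d p] dirsum_outside[of n t d p] dirsum_outside[of n "\<lambda>i. s i \<circ> t i" d p] s t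
      by simp
  qed
qed

lemma dirsum_id: "dirsum n d (\<lambda>i j. j) = (\<lambda>j. j)"
proof
  fix p show "dirsum n d (\<lambda>i j. j) p = p"
    by (induction n) auto
qed

lemma dirsum_cong:
  assumes "\<And>i. i \<in> {1..n} \<Longrightarrow> d i = e i" "\<And>i. i \<in> {1..n} \<Longrightarrow> s i = t i"
  shows "dirsum n d s = dirsum n e t"
proof
  fix p show "dirsum n d s p = dirsum n e t p"
    using assms
  proof (induction n)
    case (Suc n)
    have "offset d (Suc n) = offset e (Suc n)"
      unfolding offset_def using Suc.prems(1) by (intro sum.cong) auto
    then show ?case using Suc by simp
  qed simp
qed

lemma card_blocks:
  "card {p. p < (\<Sum>i=1..n. d i) \<and> P p} = (\<Sum>i=1..n. card {q. q < d i \<and> P (offset d i + q)})"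
proof -
  have "bij_betw (\<lambda>(i, q). offset d i + q) (SIGMA i:{1..n}. {q. q < d i \<and> P (offset d i + q)})
      {p. p < (\<Sum>i=1..n. d i) \<and> P p}"
    unfolding bij_betw_def
  proof (intro conjI)
    show "inj_on (\<lambda>(i, q). offset d i + q) (SIGMA i:{1..n}. {q. q < d i \<and> P (offset d i + q)})"
      by (rule inj_on_subset[OF bij_betw_imp_inj_on[OF bij_betw_blocks]]) auto
    show "(\<lambda>(i, q). offset d i + q) ` (SIGMA i:{1..n}. {q. q < d i \<and> P (offset d i + q)}) =
        {p. p < (\<Sum>i=1..n. d i) \<and> P p}"
    proof (intro equalityI subsetI)
      fix p assume p: "p \<in> {p. p < (\<Sum>i=1..n. d i) \<and> P p}"
      then have "p < (\<Sum>i=1..n. d i)" by simp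
      then obtain i q where "i \<in> {1..n}" "q < d i" "p = offset d i + q" by (rule block_cases)
      then show "p \<in> (\<lambda>(i, q). offset d i + q) ` (SIGMA i:{1..n}. {q. q < d i \<and> P (offset d i + q)})"
        using p by (intro image_eqI[of _ _ "(i, q)"]) auto
    next
      fix p assume "p \<in> (\<lambda>(i, q). offset d i + q) ` (SIGMA i:{1..n}. {q. q < d i \<and> P (offset d i + q)})"
      then obtain i q where "i \<in> {1..n}" "q < d i" "P (offset d i + q)" "p = offset d i + q" by auto
      then show "p \<in> {p. p < (\<Sum>i=1..n. d i) \<and> P p}"
        using block_less_sum[of i n q d] by simp
    qed
  qed
  from bij_betw_same_card[OF this] show ?thesis by (simp add: card_SigmaI)
qed

text \<open>The proportion in the union is the average of the proportions in the blocks, weighted by the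
relative sizes of the blocks; every weight is at most \<open>1\<close>.\<close>

lemma proportion_blocks_le:
  "proportion (\<Sum>i=1..n. d i) P \<le> (\<Sum>i=1..n. proportion (d i) (\<lambda>q. P (offset d i + q)))"
proof -
  have "real (card {q. q < d i \<and> P (offset d i + q)}) / real (\<Sum>i=1..n. d i) \<le>
      real (card {q. q < d i \<and> P (offset d i + q)}) / real (d i)" if "i \<in> {1..n}" for i
  proof (cases "d i = 0")
    case False
    moreover have "d i \<le> (\<Sum>i=1..n. d i)" using that by (intro member_le_sum) auto
    ultimately show ?thesis
      by (intro divide_left_mono mult_pos_pos) (simp_all del: of_nat_sum)
  qed simp
  then show ?thesis
    unfolding proportion_def card_blocks of_nat_sum sum_divide_distrib by (intro sum_mono) auto
qed

lemma dirsum_permutes: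
  assumes s: "\<And>i. i \<in> {1..n} \<Longrightarrow> s i permutes {..<d i}"
  shows "dirsum n d s permutes {..<\<Sum>i=1..n. d i}"
proof -
  have i: "inv_into UNIV (s i) permutes {..<d i}" if "i \<in> {1..n}" for i
    using s that permutes_inv by blast
  have "dirsum n d s \<circ> dirsum n d (\<lambda>i. inv_into UNIV (s i)) =
      dirsum n d (\<lambda>i. s i \<circ> inv_into UNIV (s i))"
    by (rule dirsum_comp[symmetric]) (use s i in auto)
  also have "\<dots> = (\<lambda>j. j)"
    by (rule trans[OF dirsum_cong[OF refl] dirsum_id]) (use permutes_inverses(1)[OF s] in auto)
  finally have 1: "dirsum n d s \<circ> dirsum n d (\<lambda>i. inv_into UNIV (s i)) = (\<lambda>j. j)" .
  have "dirsum n d (\<lambda>i. inv_into UNIV (s i)) \<circ> dirsum n d s =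
      dirsum n d (\<lambda>i. inv_into UNIV (s i) \<circ> s i)"
    by (rule dirsum_comp[symmetric]) (use s i in auto)
  also have "\<dots> = (\<lambda>j. j)"
    by (rule trans[OF dirsum_cong[OF refl] dirsum_id]) (use permutes_inverses(2)[OF s] in auto)
  finally have 2: "dirsum n d (\<lambda>i. inv_into UNIV (s i)) \<circ> dirsum n d s = (\<lambda>j. j)" .
  show ?thesis
    by (rule permutes_if_inverse[OF 1 2]) (use dirsum_outside[of n s d] s in auto)
qed

text \<open>Induction on the number of blocks, along the recursion of \<^const>\<open>dirsum\<close>.\<close>

lemma diag_block_mat_perm_mat:
  assumes s: "\<And>i. i \<in> {1..n} \<Longrightarrow> s i permutes {..<d i}"
  shows "diag_block_mat (map (\<lambda>i. perm_mat (d i) (s i)) [1..<Suc n]) = perm_mat (\<Sum>i=1..n. d i) (dirsum n d s)"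
  using s
proof (induction n)
  case (Suc n)
  let ?D = "offset d (Suc n)"
  have IH: "diag_block_mat (map (\<lambda>i. perm_mat (d i) (s i)) [1..<Suc n]) = perm_mat ?D (dirsum n d s)"
    using Suc unfolding sum_eq_offset by simp
  have D: "(\<Sum>i=1..Suc n. d i) = ?D + d (Suc n)"
    unfolding sum_eq_offset by (simp add: offset_Suc)
  have lo: "dirsum n d s p < ?D" if "p < ?D" for p
    using permutes_in_image[OF dirsum_permutes[of n s d], of p] Suc.prems that
    unfolding sum_eq_offset by simp
  have hi: "s (Suc n) q < d (Suc n)" if "q < d (Suc n)" for q
    using permutes_in_image[OF Suc.prems[of "Suc n"], of q] that by simp
  have "diag_block_mat (map (\<lambda>i. perm_mat (d i) (s i)) [1..<Suc (Suc n)]) =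
      four_block_mat (perm_mat ?D (dirsum n d s)) (0\<^sub>m ?D (d (Suc n)))
        (0\<^sub>m (d (Suc n)) ?D) (perm_mat (d (Suc n)) (s (Suc n)))"
    using diag_block_mat_last[of "map (\<lambda>i. perm_mat (d i) (s i)) [1..<Suc n]" "perm_mat (d (Suc n)) (s (Suc n))"]
    unfolding IH by (simp add: Let_def)
  also have "\<dots> = perm_mat (?D + d (Suc n)) (dirsum (Suc n) d s)"
  proof (rule eq_matI)
    fix i j assume "i < dim_row (perm_mat (?D + d (Suc n)) (dirsum (Suc n) d s))"
      "j < dim_col (perm_mat (?D + d (Suc n)) (dirsum (Suc n) d s))"
    then have i: "i < ?D + d (Suc n)" and j: "j < ?D + d (Suc n)" by simp_all
    show "four_block_mat (perm_mat ?D (dirsum n d s)) (0\<^sub>m ?D (d (Suc n)))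
        (0\<^sub>m (d (Suc n)) ?D) (perm_mat (d (Suc n)) (s (Suc n))) $$ (i, j) =
        perm_mat (?D + d (Suc n)) (dirsum (Suc n) d s) $$ (i, j)"
      using i j lo[of j] hi[of "j - ?D"] by (auto simp: perm_mat_index)
  qed auto
  finally show ?case unfolding D .
qed (auto simp: perm_mat_def)

text \<open>Multiplying all block sizes by \<open>r\<close> multiplies the offsets by \<open>r\<close>, so the quotient and the remainder
of a point modulo \<open>r\<close> are computed inside its block.\<close>

lemma amp_dirsum:
  assumes r: "r > 0" and s: "\<And>i. i \<in> {1..n} \<Longrightarrow> s i permutes {..<d i}"
  shows "amp r (dirsum n d s) = dirsum n (\<lambda>i. d i * r) (\<lambda>i. amp r (s i))"
proof
  fix p
  have off: "offset (\<lambda>i. d i * r) i = offset d i * r" for i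
    by (simp add: offset_def sum_distrib_right)
  have D: "(\<Sum>i=1..n. d i * r) = (\<Sum>i=1..n. d i) * r"
    by (simp add: sum_distrib_right)
  show "amp r (dirsum n d s) p = dirsum n (\<lambda>i. d i * r) (\<lambda>i. amp r (s i)) p"
  proof (cases "p < (\<Sum>i=1..n. d i * r)")
    case True
    then obtain i q where iq: "i \<in> {1..n}" "q < d i * r" "p = offset (\<lambda>i. d i * r) i + q"
      by (rule block_cases)
    have "dirsum n (\<lambda>i. d i * r) (\<lambda>i. amp r (s i)) p = offset d i * r + amp r (s i) q"
      using dirsum_block[of i n q "\<lambda>i. d i * r" "\<lambda>i. amp r (s i)"] iq by (simp add: off)
    moreover have "p div r = offset d i + q div r" "p mod r = q mod r"
      using r by (simp_all add: iq off)
    moreover have "dirsum n d s (offset d i + q div r) = offset d i + s i (q div r)"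
      using iq by (intro dirsum_block) (auto simp: less_mult_imp_div_less)
    ultimately show ?thesis by (simp add: amp_def algebra_simps)
  next
    case False
    then have "dirsum n (\<lambda>i. d i * r) (\<lambda>i. amp r (s i)) p = p"
      by (intro dirsum_outside amp_permutes r s) auto
    moreover have "dirsum n d s permutes {..<\<Sum>i=1..n. d i}"
      by (rule dirsum_permutes) (rule s)
    then have "amp r (dirsum n d s) p = p"
      using permutes_not_in[OF amp_permutes[OF r], of _ _ p] False unfolding D by simp
    ultimately show ?thesis by simp
  qed
qed

section \<open>Matching two block decompositions\<close>

text \<open>The complements of the domain and of the range have the same cardinality, so any bijection
between them completes the injection.\<close>

lemma extend_inj_to_permutation:
  assumes X: "finite X" and f: "inj_on f A" and A: "A \<subseteq> X" and fA: "f ` A \<subseteq> X"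
  obtains U where "U permutes X" "\<And>x. x \<in> A \<Longrightarrow> U x = f x"
proof -
  have "card (X - A) = card (X - f ` A)"
    using card_Diff_subset[OF finite_subset[OF A X] A] card_Diff_subset[OF finite_subset[OF fA X] fA]
      card_image[OF f] by simp
  then obtain g where g: "bij_betw g (X - A) (X - f ` A)"
    using finite_same_card_bij[OF finite_Diff[OF X] finite_Diff[OF X]] by blast
  define U where "U = (\<lambda>x. if x \<in> A then f x else if x \<in> X then g x else x)"
  have "bij_betw U A (f ` A)"
    using f by (auto simp: U_def bij_betw_def inj_on_def)
  moreover have "bij_betw U (X - A) (X - f ` A)"
    using g by (subst bij_betw_cong[of "X - A" U g]) (auto simp: U_def)
  ultimately have "bij_betw U (A \<union> (X - A)) (f ` A \<union> (X - f ` A))"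
    by (rule bij_betw_combine) auto
  moreover have "A \<union> (X - A) = X" "f ` A \<union> (X - f ` A) = X" using A fA by auto
  ultimately have "bij_betw U X X" by simp
  then have "U permutes X" by (rule bij_imp_permutes) (use A in \<open>auto simp: U_def\<close>)
  then show ?thesis by (rule that) (simp add: U_def)
qed

text \<open>Two decompositions of the same set are given: one into \<open>a i\<close> and one into \<open>b i\<close> copies of a set of
size \<open>d i\<close>, for each \<open>i\<close>. The permutation \<open>U\<close> sends the point \<open>j\<close> of the \<open>c\<close>-th copy to the point \<open>u i j\<close> of
the \<open>c\<close>-th copy whenever \<open>c < min (a i) (b i)\<close>, and is arbitrary elsewhere. Since permutations acting as \<open>x i\<close> on each
copy preserve the number \<open>c\<close> of the copy, \<open>U\<close> can only fail to intertwine \<open>x\<close> and \<open>y\<close> at a point lying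
in a copy without partner, or over a point \<open>q\<close> with \<open>y i (u i q) \<noteq> u i (x i q)\<close>. The permutation \<open>U\<close> is chosen
before \<open>x\<close> and \<open>y\<close>, so that it can serve all group elements at once.\<close>

lemma block_matching:
  assumes D: "(\<Sum>i=1..n. d i * a i) = (\<Sum>i=1..n. d i * b i)"
    and u: "\<And>i. i \<in> {1..n} \<Longrightarrow> u i permutes {..<d i}"
  obtains U where "U permutes {..<\<Sum>i=1..n. d i * a i}"
    "\<And>x y. (\<And>i. i \<in> {1..n} \<Longrightarrow> x i permutes {..<d i}) \<Longrightarrow>
       card {p. p < (\<Sum>i=1..n. d i * a i) \<and>
          dirsum n (\<lambda>i. d i * b i) (\<lambda>i. amp (b i) (y i)) (U p) \<noteq>
          U (dirsum n (\<lambda>i. d i * a i) (\<lambda>i. amp (a i) (x i)) p)}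
       \<le> (\<Sum>i=1..n. card {q. q < d i \<and> y i (u i q) \<noteq> u i (x i q)} * a i + d i * (a i - b i))"
proof -
  define Ea where "Ea = (\<lambda>(i, q). offset (\<lambda>i. d i * a i) i + q)"
  define Eb where "Eb = (\<lambda>(i, q). offset (\<lambda>i. d i * b i) i + q)"
  define Ta where "Ta = (SIGMA i:{1..n}. {..<d i * a i})"
  define Tb where "Tb = (SIGMA i:{1..n}. {..<d i * b i})"
  \<comment> \<open>Inside a block, \<open>q div a i\<close> is a point of the copied set and \<open>q mod a i\<close> is the number of the copy;
    \<open>T0\<close> consists of the points in copies that have a partner.\<close>
  define T0 where "T0 = (SIGMA i:{1..n}. {q. q < d i * a i \<and> q mod a i < b i})"
  define G where "G = (\<lambda>(i, q). (i, u i (q div a i) * b i + q mod a i))"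
  define f where "f = Eb \<circ> G \<circ> inv_into Ta Ea"
  let ?D = "\<Sum>i=1..n. d i * a i"
  have Ea: "bij_betw Ea Ta {..<?D}" unfolding Ea_def Ta_def by (rule bij_betw_blocks)
  have Eb: "bij_betw Eb Tb {..<?D}" unfolding Eb_def Tb_def D by (rule bij_betw_blocks)
  have T0: "T0 \<subseteq> Ta" unfolding T0_def Ta_def by auto
  have u_less: "u i j < d i" if "i \<in> {1..n}" "j < d i" for i j
    using permutes_in_image[OF u[OF that(1)], of j] that(2) by simp
  have G: "G ` T0 \<subseteq> Tb"
  proof (rule image_subsetI, clarify)
    fix i q assume "(i, q) \<in> T0"
    then have iq: "i \<in> {1..n}" "q < d i * a i" "q mod a i < b i" by (auto simp: T0_def)
    then have "u i (q div a i) < d i" by (intro u_less) (auto simp: less_mult_imp_div_less)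
    then show "G (i, q) \<in> Tb"
      using iq amp_less[of "b i" "u i (q div a i)" "d i" "q mod a i"] by (auto simp: G_def Tb_def)
  qed
  have "inj_on G T0"
  proof (rule inj_onI, clarify)
    fix i q i' q' assume *: "(i, q) \<in> T0" "(i', q') \<in> T0" "G (i, q) = G (i', q')"
    then have i: "i' = i" by (simp add: G_def)
    have lt: "i \<in> {1..n}" "q mod a i < b i" "q' mod a i < b i" using * i by (auto simp: T0_def)
    have eq: "u i (q div a i) * b i + q mod a i = u i (q' div a i) * b i + q' mod a i"
      using * i by (simp add: G_def)
    have "u i (q div a i) = u i (q' div a i)"
      using arg_cong[OF eq, of "\<lambda>z. z div b i"] lt by simp
    then have "q div a i = q' div a i"
      using permutes_inj[OF u[OF lt(1)]] by (auto dest: injD)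
    moreover have "q mod a i = q' mod a i"
      using arg_cong[OF eq, of "\<lambda>z. z mod b i"] lt by simp
    ultimately show "i = i' \<and> q = q'" using i by (metis div_mult_mod_eq)
  qed
  then have "inj_on (Eb \<circ> G) T0"
    using inj_on_subset[OF bij_betw_imp_inj_on[OF Eb] G] by (rule comp_inj_on)
  have fE: "f (Ea t) = Eb (G t)" if "t \<in> Ta" for t
    using inv_into_f_f[OF bij_betw_imp_inj_on[OF Ea] that] by (simp add: f_def)
  have "inj_on f (Ea ` T0)"
  proof (rule inj_onI)
    fix p p' assume "p \<in> Ea ` T0" "p' \<in> Ea ` T0" "f p = f p'"
    then obtain t t' where t: "t \<in> T0" "t' \<in> T0" "p = Ea t" "p' = Ea t'" "f (Ea t) = f (Ea t')"
      by blast
    then have "(Eb \<circ> G) t = (Eb \<circ> G) t'" using fE[OF subsetD[OF T0]] by simp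
    then have "t = t'" using inj_onD[OF \<open>inj_on (Eb \<circ> G) T0\<close>] t(1,2) by blast
    then show "p = p'" using t by simp
  qed
  moreover have "Ea ` T0 \<subseteq> {..<?D}"
    using image_mono[OF T0, of Ea] bij_betw_imp_surj_on[OF Ea] by simp
  moreover have "f ` (Ea ` T0) \<subseteq> {..<?D}"
  proof safe
    fix t assume "t \<in> T0"
    then have "f (Ea t) = Eb (G t)" "G t \<in> Tb" using fE[OF subsetD[OF T0]] G by blast+
    then show "f (Ea t) < ?D" using bij_betw_imp_surj_on[OF Eb] by auto
  qed
  ultimately obtain U where U: "U permutes {..<?D}" and Uf: "\<And>p. p \<in> Ea ` T0 \<Longrightarrow> U p = f p"
    using extend_inj_to_permutation[of "{..<?D}" f "Ea ` T0"] by blast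
  have U_block: "U (offset (\<lambda>i. d i * a i) i + q) =
      offset (\<lambda>i. d i * b i) i + (u i (q div a i) * b i + q mod a i)"
    if "i \<in> {1..n}" "q < d i * a i" "q mod a i < b i" for i q
  proof -
    have t: "(i, q) \<in> T0" using that by (simp add: T0_def)
    then have "U (Ea (i, q)) = Eb (G (i, q))" using Uf fE T0 by auto
    then show ?thesis by (simp add: Ea_def Eb_def G_def)
  qed
  show ?thesis
  proof (rule that[OF U])
    fix x y :: "nat \<Rightarrow> nat \<Rightarrow> nat" assume x: "\<And>i. i \<in> {1..n} \<Longrightarrow> x i permutes {..<d i}"
    define X where "X = dirsum n (\<lambda>i. d i * a i) (\<lambda>i. amp (a i) (x i))"
    define Y where "Y = dirsum n (\<lambda>i. d i * b i) (\<lambda>i. amp (b i) (y i))"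
    let ?bad = "\<lambda>i j. y i (u i j) \<noteq> u i (x i j)"
    have mismatch: "?bad i (q div a i) \<or> b i \<le> q mod a i"
      if i: "i \<in> {1..n}" and q: "q < d i * a i"
        and ne: "Y (U (offset (\<lambda>i. d i * a i) i + q)) \<noteq> U (X (offset (\<lambda>i. d i * a i) i + q))" for i q
    proof (rule ccontr)
      \<comment> \<open>Otherwise \<open>U\<close> is given by \<open>u i\<close> both at the point and at its image under \<open>X\<close>, which lies in the same copy.\<close>
      assume "\<not> (?bad i (q div a i) \<or> b i \<le> q mod a i)"
      then have eq: "y i (u i (q div a i)) = u i (x i (q div a i))" and lt: "q mod a i < b i" by auto
      have a: "a i > 0" using q by (cases "a i = 0") auto
      have j: "q div a i < d i" using q by (simp add: less_mult_imp_div_less)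
      have xj: "x i (q div a i) < d i" using permutes_in_image[OF x[OF i], of "q div a i"] j by simp
      have "X (offset (\<lambda>i. d i * a i) i + q) =
          offset (\<lambda>i. d i * a i) i + (x i (q div a i) * a i + q mod a i)"
        unfolding X_def using i q by (subst dirsum_block) (auto simp: amp_def)
      also have "U \<dots> = offset (\<lambda>i. d i * b i) i + (u i (x i (q div a i)) * b i + q mod a i)"
        using U_block[of i "x i (q div a i) * a i + q mod a i"] i lt a xj
          amp_less[of "a i" "x i (q div a i)" "d i" "q mod a i"] by simp
      also have "\<dots> = Y (offset (\<lambda>i. d i * b i) i + (u i (q div a i) * b i + q mod a i))"
        unfolding Y_def
        using i lt eq amp_less[of "b i" "u i (q div a i)" "d i" "q mod a i"] u_less[OF i j]
        by (subst dirsum_block) (auto simp: amp_def)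
      also have "\<dots> = Y (U (offset (\<lambda>i. d i * a i) i + q))"
        using U_block[OF i q lt] by simp
      finally show False using ne by simp
    qed
    have "card {p. p < ?D \<and> Y (U p) \<noteq> U (X p)} =
        (\<Sum>i=1..n. card {q. q < d i * a i \<and>
          Y (U (offset (\<lambda>i. d i * a i) i + q)) \<noteq> U (X (offset (\<lambda>i. d i * a i) i + q))})"
      by (rule card_blocks)
    also have "\<dots> \<le> (\<Sum>i=1..n. card {q. q < d i \<and> ?bad i q} * a i + d i * (a i - b i))"
    proof (rule sum_mono)
      fix i assume i: "i \<in> {1..n}"
      have "card {q. q < d i * a i \<and> Y (U (offset (\<lambda>i. d i * a i) i + q)) \<noteq> U (X (offset (\<lambda>i. d i * a i) i + q))}
          \<le> card ({q. q < d i * a i \<and> ?bad i (q div a i) \<and> True} \<union> {q. q < d i * a i \<and> True \<and> b i \<le> q mod a i})"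
        by (rule card_mono) (use mismatch[OF i] in auto)
      also have "\<dots> \<le> card {q. q < d i * a i \<and> ?bad i (q div a i) \<and> True} +
          card {q. q < d i * a i \<and> True \<and> b i \<le> q mod a i}"
        by (rule card_Un_le)
      also have "\<dots> = card {q. q < d i \<and> ?bad i q} * a i + d i * card {q. q < a i \<and> b i \<le> q}"
        using card_div_mod[of "d i" "a i" "?bad i" "\<lambda>_. True"]
          card_div_mod[of "d i" "a i" "\<lambda>_. True" "\<lambda>q. b i \<le> q"] by simp
      also have "{q. q < a i \<and> b i \<le> q} = {b i..<a i}" by auto
      finally show "card {q. q < d i * a i \<and> Y (U (offset (\<lambda>i. d i * a i) i + q)) \<noteq> U (X (offset (\<lambda>i. d i * a i) i + q))}
          \<le> card {q. q < d i \<and> ?bad i q} * a i + d i * (a i - b i)" by simp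
    qed
    finally show "card {p. p < ?D \<and> dirsum n (\<lambda>i. d i * b i) (\<lambda>i. amp (b i) (y i)) (U p) \<noteq>
          U (dirsum n (\<lambda>i. d i * a i) (\<lambda>i. amp (a i) (x i)) p)}
       \<le> (\<Sum>i=1..n. card {q. q < d i \<and> ?bad i q} * a i + d i * (a i - b i))"
      unfolding X_def Y_def .
  qed
qed

text \<open>The matching at each index, turned into a statement about limits: the copies contribute at most the
disagreement of \<open>y i \<circ> u i\<close> with \<open>u i \<circ> x i\<close>, and the copies without partner at most the difference of
the relative sizes of the two \<open>i\<close>-th summands.\<close>

lemma matching_near:
  fixes d a b :: "nat \<Rightarrow> nat \<Rightarrow> nat" and n :: nat
  defines "D \<equiv> \<lambda>k. \<Sum>i=1..n. d i k * a i k"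
  assumes D: "\<And>k. D k = (\<Sum>i=1..n. d i k * b i k)"
    and u: "\<And>i. i \<in> {1..n} \<Longrightarrow> perm_seq (d i) (u i)"
    and lim: "\<And>i. i \<in> {1..n} \<Longrightarrow>
      ((\<lambda>k. real (d i k * a i k) / real (D k) - real (d i k * b i k) / real (D k)) \<longlongrightarrow> 0) \<omega>"
  obtains U where "perm_seq D U"
    "\<And>x y. (\<And>i. i \<in> {1..n} \<Longrightarrow> perm_seq (d i) (x i)) \<Longrightarrow>
       (\<And>i. i \<in> {1..n} \<Longrightarrow> near \<omega> (d i) (\<lambda>k. y i k \<circ> u i k) (\<lambda>k. u i k \<circ> x i k)) \<Longrightarrow>
       near \<omega> D (\<lambda>k. dirsum n (\<lambda>i. d i k * b i k) (\<lambda>i. amp (b i k) (y i k)) \<circ> U k)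
         (\<lambda>k. U k \<circ> dirsum n (\<lambda>i. d i k * a i k) (\<lambda>i. amp (a i k) (x i k)))"
proof -
  define matches where "matches k U \<longleftrightarrow> U permutes {..<D k} \<and>
      (\<forall>x y. (\<forall>i\<in>{1..n}. x i permutes {..<d i k}) \<longrightarrow>
        card {p. p < D k \<and> dirsum n (\<lambda>i. d i k * b i k) (\<lambda>i. amp (b i k) (y i)) (U p) \<noteq>
          U (dirsum n (\<lambda>i. d i k * a i k) (\<lambda>i. amp (a i k) (x i)) p)}
        \<le> (\<Sum>i=1..n. card {q. q < d i k \<and> y i (u i k q) \<noteq> u i k (x i q)} * a i k +
            d i k * (a i k - b i k)))" for k U
  have "\<exists>U. matches k U" for k
  proof (rule block_matching[where n = n and d = "\<lambda>i. d i k" and a = "\<lambda>i. a i k"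
        and b = "\<lambda>i. b i k" and u = "\<lambda>i. u i k"])
    show "(\<Sum>i=1..n. d i k * a i k) = (\<Sum>i=1..n. d i k * b i k)"
      using D[of k] by (simp add: D_def)
    show "u i k permutes {..<d i k}" if "i \<in> {1..n}" for i
      using u[OF that] by (simp add: perm_seq_def)
  qed (unfold matches_def D_def, blast)
  then obtain U where "\<And>k. matches k (U k)" by metis
  then have U: "\<And>k. U k permutes {..<D k}"
    and card: "\<And>k x y. (\<And>i. i \<in> {1..n} \<Longrightarrow> x i permutes {..<d i k}) \<Longrightarrow>
      card {p. p < D k \<and> dirsum n (\<lambda>i. d i k * b i k) (\<lambda>i. amp (b i k) (y i)) (U k p) \<noteq>
          U k (dirsum n (\<lambda>i. d i k * a i k) (\<lambda>i. amp (a i k) (x i)) p)}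
       \<le> (\<Sum>i=1..n. card {q. q < d i k \<and> y i (u i k q) \<noteq> u i k (x i q)} * a i k +
            d i k * (a i k - b i k))"
    unfolding matches_def by blast+
  show ?thesis
  proof (rule that)
    show "perm_seq D U" using U by (simp add: perm_seq_def)
    fix x y :: "nat \<Rightarrow> nat \<Rightarrow> nat \<Rightarrow> nat"
    assume x: "\<And>i. i \<in> {1..n} \<Longrightarrow> perm_seq (d i) (x i)"
      and xy: "\<And>i. i \<in> {1..n} \<Longrightarrow> near \<omega> (d i) (\<lambda>k. y i k \<circ> u i k) (\<lambda>k. u i k \<circ> x i k)"
    let ?bad = "\<lambda>i k q. (y i k \<circ> u i k) q \<noteq> (u i k \<circ> x i k) q"
    let ?gap = "\<lambda>i k. \<bar>real (d i k * a i k) / real (D k) - real (d i k * b i k) / real (D k)\<bar>"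
    show "near \<omega> D (\<lambda>k. dirsum n (\<lambda>i. d i k * b i k) (\<lambda>i. amp (b i k) (y i k)) \<circ> U k)
         (\<lambda>k. U k \<circ> dirsum n (\<lambda>i. d i k * a i k) (\<lambda>i. amp (a i k) (x i k)))"
      unfolding near_def
    proof (rule tendsto_zero_nonneg_le)
      show "((\<lambda>k. \<Sum>i=1..n. proportion (d i k) (?bad i k) + ?gap i k) \<longlongrightarrow> 0) \<omega>"
      proof (rule tendsto_null_sum)
        fix i assume i: "i \<in> {1..n}"
        show "((\<lambda>k. proportion (d i k) (?bad i k) + ?gap i k) \<longlongrightarrow> 0) \<omega>"
          using tendsto_add[OF xy[OF i, unfolded near_def] tendsto_rabs_zero[OF lim[OF i]]] by simp
      qed
      fix k
      show "proportion (D k) (\<lambda>p. (dirsum n (\<lambda>i. d i k * b i k) (\<lambda>i. amp (b i k) (y i k)) \<circ> U k) p \<noteq>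
         (U k \<circ> dirsum n (\<lambda>i. d i k * a i k) (\<lambda>i. amp (a i k) (x i k))) p)
        \<le> (\<Sum>i=1..n. proportion (d i k) (?bad i k) + ?gap i k)" (is "proportion _ ?mis \<le> _")
      proof -
        have "card {p. p < D k \<and> ?mis p} \<le>
            (\<Sum>i=1..n. card {q. q < d i k \<and> ?bad i k q} * a i k + d i k * (a i k - b i k))"
          using card[of "\<lambda>i. x i k" k "\<lambda>i. y i k"] x by (simp add: perm_seq_def)
        then have "proportion (D k) ?mis \<le>
            real (\<Sum>i=1..n. card {q. q < d i k \<and> ?bad i k q} * a i k + d i k * (a i k - b i k)) / real (D k)"
          unfolding proportion_def by (intro divide_right_mono of_nat_mono) simp_all
        also have "\<dots> = (\<Sum>i=1..n. real (card {q. q < d i k \<and> ?bad i k q} * a i k) / real (D k) +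
            real (d i k * (a i k - b i k)) / real (D k))"
          by (simp only: of_nat_sum of_nat_add sum_divide_distrib add_divide_distrib)
        also have "\<dots> \<le> (\<Sum>i=1..n. proportion (d i k) (?bad i k) + ?gap i k)"
        proof (intro sum_mono add_mono)
          fix i assume i: "i \<in> {1..n}"
          have le: "d i k * a i k \<le> D k" unfolding D_def by (rule member_le_sum) (use i in auto)
          \<comment> \<open>The \<open>a i k\<close> copies occupy \<open>d i k * a i k\<close> points, hence at most \<open>D k\<close>.\<close>
          show "real (card {q. q < d i k \<and> ?bad i k q} * a i k) / real (D k) \<le> proportion (d i k) (?bad i k)"
          proof (cases "d i k * a i k = 0")
            case False
            with le have "D k > 0" by linarith
            with False have "real (card {q. q < d i k \<and> ?bad i k q} * a i k) / real (D k) \<le>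
                real (card {q. q < d i k \<and> ?bad i k q} * a i k) / real (d i k * a i k)"
              using le by (intro divide_left_mono mult_pos_pos of_nat_mono) auto
            also have "\<dots> = proportion (d i k) (?bad i k)"
              using False by (simp add: proportion_def)
            finally show ?thesis .
          qed (auto simp: proportion_nonneg)
          have "real (d i k * (a i k - b i k)) \<le> \<bar>real (d i k * a i k) - real (d i k * b i k)\<bar>"
            by (cases "b i k \<le> a i k") (auto simp: of_nat_diff right_diff_distrib)
          then show "real (d i k * (a i k - b i k)) / real (D k) \<le> ?gap i k"
            unfolding diff_divide_distrib[symmetric] abs_divide by (simp add: divide_right_mono)
        qed
        finally show ?thesis .
      qed
    qed (rule proportion_nonneg)
  qed
qed

section \<open>Amplifications and direct sums of sequences of permutations\<close>

lemma near_amp: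
  assumes "\<And>k. r k > 0" "near \<omega> n s t"
  shows "near \<omega> (\<lambda>k. n k * r k) (\<lambda>k. amp (r k) (s k)) (\<lambda>k. amp (r k) (t k))"
proof -
  have "proportion (n k * r k) (\<lambda>p. amp (r k) (s k) p \<noteq> amp (r k) (t k) p) =
      proportion (n k) (\<lambda>j. s k j \<noteq> t k j)" for k
    unfolding amp_eq_iff[OF assms(1)] by (rule proportion_amp[OF assms(1)])
  then show ?thesis using assms(2) by (simp add: near_def)
qed

lemma proportion_dirsum_le:
  assumes "\<And>i q. i \<in> {1..n} \<Longrightarrow> q < d i \<Longrightarrow> P (offset d i + q) \<Longrightarrow> Q i q"
  shows "proportion (\<Sum>i=1..n. d i) P \<le> (\<Sum>i=1..n. proportion (d i) (Q i))"
  by (rule order_trans[OF proportion_blocks_le]) (intro sum_mono proportion_mono assms)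

lemma near_dirsum:
  assumes "\<And>i. i \<in> {1..n} \<Longrightarrow> near \<omega> (d i) (s i) (t i)"
  shows "near \<omega> (\<lambda>k. \<Sum>i=1..n. d i k) (\<lambda>k. dirsum n (\<lambda>i. d i k) (\<lambda>i. s i k))
    (\<lambda>k. dirsum n (\<lambda>i. d i k) (\<lambda>i. t i k))"
  unfolding near_def
proof (rule tendsto_zero_nonneg_le)
  show "((\<lambda>k. \<Sum>i=1..n. proportion (d i k) (\<lambda>q. s i k q \<noteq> t i k q)) \<longlongrightarrow> 0) \<omega>"
    using assms unfolding near_def by (rule tendsto_null_sum)
  show "proportion (\<Sum>i=1..n. d i k)
      (\<lambda>p. dirsum n (\<lambda>i. d i k) (\<lambda>i. s i k) p \<noteq> dirsum n (\<lambda>i. d i k) (\<lambda>i. t i k) p)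
    \<le> (\<Sum>i=1..n. proportion (d i k) (\<lambda>q. s i k q \<noteq> t i k q))" for k
    by (rule proportion_dirsum_le) (simp add: dirsum_block[of _ n _ "\<lambda>i. d i k"])
qed (rule proportion_nonneg)

lemma perm_seq_amp:
  assumes "\<And>k. r k > 0" "perm_seq n s"
  shows "perm_seq (\<lambda>k. n k * r k) (\<lambda>k. amp (r k) (s k))"
  using assms by (simp add: perm_seq_def amp_permutes)

lemma perm_seq_dirsum:
  assumes "\<And>i. i \<in> {1..n} \<Longrightarrow> perm_seq (d i) (s i)"
  shows "perm_seq (\<lambda>k. \<Sum>i=1..n. d i k) (\<lambda>k. dirsum n (\<lambda>i. d i k) (\<lambda>i. s i k))"
  unfolding perm_seq_def
proof
  fix k show "dirsum n (\<lambda>i. d i k) (\<lambda>i. s i k) permutes {..<\<Sum>i=1..n. d i k}"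
    by (rule dirsum_permutes) (use assms in \<open>simp add: perm_seq_def\<close>)
qed

lemma perm_seq_comp: "perm_seq n s \<Longrightarrow> perm_seq n t \<Longrightarrow> perm_seq n (\<lambda>k. s k \<circ> t k)"
  by (simp add: perm_seq_def permutes_compose)

lemma perm_seq_inv: "perm_seq n s \<Longrightarrow> perm_seq n (\<lambda>k. inv_into UNIV (s k))"
  by (simp add: perm_seq_def permutes_inv)

lemma perm_seq_inv_comp:
  assumes "perm_seq n s"
  shows "s k \<circ> inv_into UNIV (s k) = id" "inv_into UNIV (s k) \<circ> s k = id"
  using assms permutes_inv_o[of "s k" "{..<n k}"] by (simp_all add: perm_seq_def)

section \<open>Permutations in the ultraproduct\<close>

definition perm_class ::
    "nat filter \<Rightarrow> (nat \<Rightarrow> nat) \<Rightarrow> (nat \<Rightarrow> nat \<Rightarrow> nat) \<Rightarrow> (nat \<Rightarrow> complex mat) set" where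
  "perm_class \<omega> n s = ultra_class \<omega> n (\<lambda>k. perm_mat (n k) (s k))"

lemma perm_mat_bounded_seqs:
  assumes "perm_seq n s"
  shows "(\<lambda>k. perm_mat (n k) (s k)) \<in> carrier (bounded_seqs n)"
  using assms op_norm_perm_mat by (auto simp: bounded_seqs_simps(1) perm_seq_def)

lemma norm2_perm_mat_diff_tendsto:
  assumes "perm_seq n s" "perm_seq n t"
  shows "((\<lambda>k. norm2 (perm_mat (n k) (s k) - perm_mat (n k) (t k))) \<longlongrightarrow> 0) \<omega> \<longleftrightarrow> near \<omega> n s t"
proof -
  let ?p = "\<lambda>k. proportion (n k) (\<lambda>j. s k j \<noteq> t k j)"
  have eq: "norm2 (perm_mat (n k) (s k) - perm_mat (n k) (t k)) = sqrt (2 * ?p k)" for k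
    using assms by (intro norm2_perm_mat_diff) (simp_all add: perm_seq_def)
  have "((\<lambda>k. sqrt (2 * ?p k)) \<longlongrightarrow> 0) \<omega> \<longleftrightarrow> (?p \<longlongrightarrow> 0) \<omega>"
  proof
    assume "((\<lambda>k. sqrt (2 * ?p k)) \<longlongrightarrow> 0) \<omega>"
    then have "((\<lambda>k. (sqrt (2 * ?p k))\<^sup>2 / 2) \<longlongrightarrow> 0\<^sup>2 / 2) \<omega>" by (intro tendsto_intros) simp_all
    then show "(?p \<longlongrightarrow> 0) \<omega>" by (simp add: proportion_nonneg)
  next
    assume "(?p \<longlongrightarrow> 0) \<omega>"
    then have "((\<lambda>k. sqrt (2 * ?p k)) \<longlongrightarrow> sqrt (2 * 0)) \<omega>" by (intro tendsto_intros)
    then show "((\<lambda>k. sqrt (2 * ?p k)) \<longlongrightarrow> 0) \<omega>" by simp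
  qed
  then show ?thesis by (simp add: eq near_def)
qed

text \<open>Sums, products and limits in the matrix ultraproduct enter the argument only through this
equivalence and the computations of products, conjugates and traces that follow.\<close>

lemma perm_class_eq_iff:
  assumes "perm_seq n s" "perm_seq n t"
  shows "perm_class \<omega> n s = perm_class \<omega> n t \<longleftrightarrow> near \<omega> n s t"
  unfolding perm_class_def
  by (simp add: ultra_class_eq_iff perm_mat_bounded_seqs norm2_perm_mat_diff_tendsto assms)

lemma perm_mat_mem_perm_class:
  assumes "perm_seq n s" "perm_seq n t"
  shows "(\<lambda>k. perm_mat (n k) (t k)) \<in> perm_class \<omega> n s \<longleftrightarrow> near \<omega> n s t"
  unfolding perm_class_def
  by (simp add: mem_ultra_class_iff perm_mat_bounded_seqs norm2_perm_mat_diff_tendsto assms)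

lemma perm_seqs_eq: "perm_seqs n = (\<lambda>s k. perm_mat (n k) (s k)) ` {s. perm_seq n s}"
proof -
  have mats: "perm_mats N = perm_mat N ` {p. p permutes {..<N}}" for N
    by (auto simp: perm_mats_def perm_mat_def)
  have "x \<in> (\<lambda>s k. perm_mat (n k) (s k)) ` {s. perm_seq n s}" if "x \<in> perm_seqs n" for x
  proof -
    have "\<forall>k. \<exists>p. p permutes {..<n k} \<and> x k = perm_mat (n k) p"
      using that unfolding perm_seqs_def mats by blast
    then obtain s where s: "\<And>k. s k permutes {..<n k}" "\<And>k. x k = perm_mat (n k) (s k)" by metis
    show ?thesis by (rule image_eqI[of _ _ s]) (use s in \<open>auto simp: perm_seq_def\<close>)
  qed
  then show ?thesis by (auto simp: perm_seqs_def mats perm_seq_def)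
qed

lemma perm_ultra_eq: "perm_ultra \<omega> n = perm_class \<omega> n ` {s. perm_seq n s}"
  by (simp add: perm_ultra_def perm_seqs_eq perm_class_def image_image)

lemma perm_class_mult:
  assumes "perm_seq n s" "perm_seq n t"
  shows "perm_class \<omega> n s \<otimes>\<^bsub>mat_ultra \<omega> n\<^esub> perm_class \<omega> n t = perm_class \<omega> n (\<lambda>k. s k \<circ> t k)"
  using assms unfolding perm_class_def
  by (simp add: ultra_class_mult perm_mat_bounded_seqs perm_mat_mult perm_seq_def)

lemma ultra_Ad_perm_class:
  assumes "perm_seq n u" "perm_seq n s"
  shows "ultra_Ad \<omega> n (perm_class \<omega> n u) (perm_class \<omega> n s) =
    perm_class \<omega> n (\<lambda>k. u k \<circ> s k \<circ> inv_into UNIV (u k))"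
proof -
  have "ultra_adjoint (perm_class \<omega> n u) = perm_class \<omega> n (\<lambda>k. inv_into UNIV (u k))"
    using assms(1) unfolding perm_class_def
    by (simp add: ultra_adjoint_class perm_mat_bounded_seqs perm_mat_adjoint perm_seq_def)
  then show ?thesis
    by (simp add: ultra_Ad_def perm_class_mult assms perm_seq_comp perm_seq_inv)
qed

text \<open>Intertwining relations can be amplified and composed without inverting \<open>u\<close>, so equivalence of
representations is used in this form.\<close>

lemma near_conj_iff:
  assumes "perm_seq n u" "perm_seq n s" "perm_seq n t"
  shows "near \<omega> n t (\<lambda>k. u k \<circ> s k \<circ> inv_into UNIV (u k)) \<longleftrightarrow>
    near \<omega> n (\<lambda>k. t k \<circ> u k) (\<lambda>k. u k \<circ> s k)"
proof
  assume "near \<omega> n t (\<lambda>k. u k \<circ> s k \<circ> inv_into UNIV (u k))"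
  then have "near \<omega> n (\<lambda>k. t k \<circ> u k) (\<lambda>k. (u k \<circ> s k \<circ> inv_into UNIV (u k)) \<circ> u k)"
    by (rule near_comp) (simp_all add: assms)
  then show "near \<omega> n (\<lambda>k. t k \<circ> u k) (\<lambda>k. u k \<circ> s k)"
    by (simp add: comp_assoc perm_seq_inv_comp[OF assms(1)])
next
  assume "near \<omega> n (\<lambda>k. t k \<circ> u k) (\<lambda>k. u k \<circ> s k)"
  then have "near \<omega> n (\<lambda>k. (t k \<circ> u k) \<circ> inv_into UNIV (u k)) (\<lambda>k. (u k \<circ> s k) \<circ> inv_into UNIV (u k))"
    by (rule near_comp) (simp_all add: assms perm_seq_inv)
  then show "near \<omega> n t (\<lambda>k. u k \<circ> s k \<circ> inv_into UNIV (u k))"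
    by (simp add: comp_assoc perm_seq_inv_comp[OF assms(1)])
qed

lemma proportion_le_1: "proportion n P \<le> 1"
proof -
  have "card {j. j < n \<and> P j} \<le> card {..<n}" by (rule card_mono) auto
  then show ?thesis by (cases "n = 0") (simp_all add: proportion_def)
qed

text \<open>By compactness the image filter has a cluster point in the unit interval, and an ultrafilter converges to each of its
cluster points.\<close>

lemma free_ultrafilter_bounded_limit:
  fixes f :: "nat \<Rightarrow> real"
  assumes uf: "free_ultrafilter \<omega>" and f: "\<And>k. 0 \<le> f k" "\<And>k. f k \<le> 1"
  obtains t where "(f \<longlongrightarrow> t) \<omega>"
proof -
  have "filtermap f \<omega> \<noteq> bot" using uf by (simp add: free_ultrafilter_def filtermap_bot_iff)
  moreover have "eventually (\<lambda>x. x \<in> {0..1}) (filtermap f \<omega>)"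
    using f by (simp add: eventually_filtermap)
  ultimately obtain t where t: "inf (nhds t) (filtermap f \<omega>) \<noteq> bot"
    using compact_filter[of "{0..1::real}"] compact_Icc by blast
  have "(f \<longlongrightarrow> t) \<omega>"
  proof (rule topological_tendstoI, rule ccontr)
    fix S assume S: "open S" "t \<in> S" and "\<not> eventually (\<lambda>k. f k \<in> S) \<omega>"
    then have "eventually (\<lambda>k. f k \<notin> S) \<omega>" using uf unfolding free_ultrafilter_def by blast
    then have "eventually (\<lambda>x. x \<notin> S) (filtermap f \<omega>)" by (simp add: eventually_filtermap)
    moreover have "eventually (\<lambda>x. x \<in> S) (nhds t)" using S by (rule eventually_nhds_in_open)
    ultimately have "eventually (\<lambda>x. False) (inf (nhds t) (filtermap f \<omega>))"
      unfolding eventually_inf by blast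
    then show False using t by (simp add: trivial_limit_def)
  qed
  then show ?thesis by (rule that)
qed

text \<open>As \<^const>\<open>ultra_tr\<close> is a definite description, its value is known only once the limit of the
traces exists and is the same for all representatives; the ultrafilter supplies the existence.\<close>

lemma ultra_tr_perm_class_eq_0_iff:
  assumes uf: "free_ultrafilter \<omega>" and s: "perm_seq n s"
  shows "ultra_tr \<omega> (perm_class \<omega> n s) = 0 \<longleftrightarrow>
    ((\<lambda>k. proportion (n k) (\<lambda>j. s k j = j)) \<longlongrightarrow> 0) \<omega>"
proof -
  let ?f = "\<lambda>k. proportion (n k) (\<lambda>j. s k j = j)" and ?P = "\<lambda>k. perm_mat (n k) (s k)"
  have bot: "\<omega> \<noteq> bot" using uf by (simp add: free_ultrafilter_def)
  obtain t where t: "(?f \<longlongrightarrow> t) \<omega>"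
    using free_ultrafilter_bounded_limit[OF uf, of ?f] proportion_nonneg proportion_le_1 by blast
  have P: "((\<lambda>k. norm_tr (?P k)) \<longlongrightarrow> complex_of_real t) \<omega>"
    unfolding norm_tr_perm_mat using t by (rule tendsto_of_real)
  have "((\<lambda>k. norm_tr (x k)) \<longlongrightarrow> complex_of_real t) \<omega>" if x: "x \<in> perm_class \<omega> n s" for x
  proof -
    have mem: "x \<in> carrier (bounded_seqs n)" and lim: "((\<lambda>k. norm2 (?P k - x k)) \<longlongrightarrow> 0) \<omega>"
      using x by (simp_all add: perm_class_def mem_ultra_class_iff perm_mat_bounded_seqs[OF s])
    have x': "x k \<in> carrier_mat (n k) (n k)" for k
      using mem by (simp add: bounded_seqs_simps(1))
    have "((\<lambda>k. norm_tr (?P k) - norm_tr (x k)) \<longlongrightarrow> 0) \<omega>"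
    proof (rule Lim_null_comparison[OF _ lim], intro always_eventually allI)
      fix k show "norm (norm_tr (?P k) - norm_tr (x k)) \<le> norm2 (?P k - x k)"
        using norm_tr_le_norm2[OF minus_carrier_mat[OF x'[of k], where A = "?P k"]]
          norm_tr_minus[OF perm_mat_carrier[of "n k" "s k"] x'[of k]] by simp
    qed
    from tendsto_diff[OF P this] show ?thesis by simp
  qed
  moreover have "?P \<in> perm_class \<omega> n s"
    using perm_mat_mem_perm_class[OF s s] by simp
  ultimately have "ultra_tr \<omega> (perm_class \<omega> n s) = complex_of_real t"
    unfolding ultra_tr_def by (intro the_equality) (auto intro: tendsto_unique[OF bot _ P])
  moreover have "t = 0 \<longleftrightarrow> (?f \<longlongrightarrow> 0) \<omega>"
    using t tendsto_unique[OF bot t] by blast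
  ultimately show ?thesis by simp
qed

text \<open>The union over all lifts collapses to one class, since lifts of the same class have amplifications
that are again at vanishing Hamming distance.\<close>

lemma amplify_perm_class:
  assumes s: "perm_seq n s" and r: "\<And>k. r k > 0" and g: "\<Theta> g = perm_class \<omega> n s"
  shows "snd (amplify \<omega> r (n, \<Theta>)) g = perm_class \<omega> (\<lambda>k. n k * r k) (\<lambda>k. amp (r k) (s k))"
proof -
  have "(\<Union>x\<in>\<Theta> g \<inter> perm_seqs n. ultra_class \<omega> (\<lambda>k. n k * r k) (\<lambda>k. kronecker (x k) (1\<^sub>m (r k)))) =
    perm_class \<omega> (\<lambda>k. n k * r k) (\<lambda>k. amp (r k) (s k))"
  proof (rule UN_constant_eq[OF _ ballI])
    show "(\<lambda>k. perm_mat (n k) (s k)) \<in> \<Theta> g \<inter> perm_seqs n"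
      using s by (simp add: g perm_mat_mem_perm_class perm_seqs_eq)
    fix x assume x: "x \<in> \<Theta> g \<inter> perm_seqs n"
    then obtain t where t: "perm_seq n t" "x = (\<lambda>k. perm_mat (n k) (t k))" "near \<omega> n s t"
      using perm_mat_mem_perm_class[OF s] by (auto simp: g perm_seqs_eq)
    have "(\<lambda>k. kronecker (x k) (1\<^sub>m (r k))) = (\<lambda>k. perm_mat (n k * r k) (amp (r k) (t k)))"
      using t(1) unfolding t(2) by (simp add: kronecker_perm_mat r perm_seq_def)
    moreover have "perm_class \<omega> (\<lambda>k. n k * r k) (\<lambda>k. amp (r k) (t k)) =
        perm_class \<omega> (\<lambda>k. n k * r k) (\<lambda>k. amp (r k) (s k))"
      using near_amp[OF r t(3)] by (simp add: perm_class_eq_iff perm_seq_amp r s t(1) near_sym)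
    ultimately show "ultra_class \<omega> (\<lambda>k. n k * r k) (\<lambda>k. kronecker (x k) (1\<^sub>m (r k))) =
        perm_class \<omega> (\<lambda>k. n k * r k) (\<lambda>k. amp (r k) (s k))"
      by (simp add: perm_class_def)
  qed
  then show ?thesis by (simp add: amplify_def)
qed

lemma direct_sum_perm_class:
  assumes s: "\<And>i. i \<in> {1..n} \<Longrightarrow> perm_seq (fst (\<Phi> i)) (s i)"
    and g: "\<And>i. i \<in> {1..n} \<Longrightarrow> snd (\<Phi> i) g = perm_class \<omega> (fst (\<Phi> i)) (s i)"
  shows "snd (direct_sum \<omega> n \<Phi>) g = perm_class \<omega> (\<lambda>k. \<Sum>i=1..n. fst (\<Phi> i) k)
    (\<lambda>k. dirsum n (\<lambda>i. fst (\<Phi> i) k) (\<lambda>i. s i k))"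
proof -
  let ?X = "{x. \<forall>i\<in>{1..n}. x i \<in> snd (\<Phi> i) g \<inter> perm_seqs (fst (\<Phi> i))}"
  let ?D = "\<lambda>k. \<Sum>i=1..n. fst (\<Phi> i) k"
  have "(\<Union>x\<in>?X. ultra_class \<omega> ?D (\<lambda>k. diag_block_mat (map (\<lambda>i. x i k) [1..<Suc n]))) =
    perm_class \<omega> ?D (\<lambda>k. dirsum n (\<lambda>i. fst (\<Phi> i) k) (\<lambda>i. s i k))"
  proof (rule UN_constant_eq[OF _ ballI])
    show "(\<lambda>i k. perm_mat (fst (\<Phi> i) k) (s i k)) \<in> ?X"
      using s g by (auto simp: perm_mat_mem_perm_class perm_seqs_eq)
    fix x assume x: "x \<in> ?X"
    have "\<exists>t. perm_seq (fst (\<Phi> i)) t \<and> x i = (\<lambda>k. perm_mat (fst (\<Phi> i) k) (t k)) \<and>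
        near \<omega> (fst (\<Phi> i)) (s i) t" if i: "i \<in> {1..n}" for i
    proof -
      have "x i \<in> perm_class \<omega> (fst (\<Phi> i)) (s i)" "x i \<in> perm_seqs (fst (\<Phi> i))"
        using x i g[OF i] by auto
      then show ?thesis using perm_mat_mem_perm_class[OF s[OF i]] by (auto simp: perm_seqs_eq)
    qed
    then obtain t where t: "\<And>i. i \<in> {1..n} \<Longrightarrow> perm_seq (fst (\<Phi> i)) (t i)"
      "\<And>i. i \<in> {1..n} \<Longrightarrow> x i = (\<lambda>k. perm_mat (fst (\<Phi> i) k) (t i k))"
      "\<And>i. i \<in> {1..n} \<Longrightarrow> near \<omega> (fst (\<Phi> i)) (s i) (t i)"
      by metis
    have "diag_block_mat (map (\<lambda>i. x i k) [1..<Suc n]) =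
        perm_mat (?D k) (dirsum n (\<lambda>i. fst (\<Phi> i) k) (\<lambda>i. t i k))" for k
    proof -
      have "map (\<lambda>i. x i k) [1..<Suc n] = map (\<lambda>i. perm_mat (fst (\<Phi> i) k) (t i k)) [1..<Suc n]"
        using t(2) by (intro map_cong) auto
      then show ?thesis
        using diag_block_mat_perm_mat[of n "\<lambda>i. t i k" "\<lambda>i. fst (\<Phi> i) k"] t(1)
        by (simp only: perm_seq_def)
    qed
    moreover have "perm_class \<omega> ?D (\<lambda>k. dirsum n (\<lambda>i. fst (\<Phi> i) k) (\<lambda>i. t i k)) =
        perm_class \<omega> ?D (\<lambda>k. dirsum n (\<lambda>i. fst (\<Phi> i) k) (\<lambda>i. s i k))"
    proof (subst perm_class_eq_iff)
      show "near \<omega> ?D (\<lambda>k. dirsum n (\<lambda>i. fst (\<Phi> i) k) (\<lambda>i. t i k))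
          (\<lambda>k. dirsum n (\<lambda>i. fst (\<Phi> i) k) (\<lambda>i. s i k))"
        by (rule near_dirsum) (simp only: near_sym[of _ _ "t _"] t(3))
    qed (rule perm_seq_dirsum, erule t(1) s)+
    ultimately show "ultra_class \<omega> ?D (\<lambda>k. diag_block_mat (map (\<lambda>i. x i k) [1..<Suc n])) =
        perm_class \<omega> ?D (\<lambda>k. dirsum n (\<lambda>i. fst (\<Phi> i) k) (\<lambda>i. s i k))"
      by (simp only: perm_class_def)
  qed
  then show ?thesis by (simp add: direct_sum_def)
qed

section \<open>Sofic representations and their equivalence\<close>

text \<open>Representations are compared through chosen permutations; identities that hold for the classes
hold for the permutations up to \<^const>\<open>near\<close>.\<close>

definition lifts ::
    "nat filter \<Rightarrow> ('g, 'h) monoid_scheme \<Rightarrow> 'g ultra_rep \<Rightarrow> ('g \<Rightarrow> nat \<Rightarrow> nat \<Rightarrow> nat) \<Rightarrow> bool" where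
  "lifts \<omega> G \<Phi> \<theta> \<longleftrightarrow>
     (\<forall>g\<in>carrier G. perm_seq (fst \<Phi>) (\<theta> g) \<and> snd \<Phi> g = perm_class \<omega> (fst \<Phi>) (\<theta> g))"

lemma sofic_reps_lifts:
  assumes "\<Phi> \<in> sofic_reps \<omega> G"
  obtains \<theta> where "lifts \<omega> G \<Phi> \<theta>"
proof -
  have "\<exists>s. perm_seq (fst \<Phi>) s \<and> snd \<Phi> g = perm_class \<omega> (fst \<Phi>) s" if "g \<in> carrier G" for g
  proof -
    have "snd \<Phi> g \<in> perm_ultra \<omega> (fst \<Phi>)"
      using assms that by (auto simp: sofic_reps_def hom_def)
    then show ?thesis by (auto simp: perm_ultra_eq)
  qed
  then have "\<exists>\<theta>. lifts \<omega> G \<Phi> \<theta>" unfolding lifts_def by metis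
  then show ?thesis using that by blast
qed

lemma sofic_reps_lifts_family:
  assumes "\<And>i. i \<in> I \<Longrightarrow> \<Phi> i \<in> sofic_reps \<omega> G"
  obtains \<theta> where "\<And>i. i \<in> I \<Longrightarrow> lifts \<omega> G (\<Phi> i) (\<theta> i)"
proof -
  have "\<forall>i\<in>I. \<exists>\<theta>. lifts \<omega> G (\<Phi> i) \<theta>"
    using sofic_reps_lifts assms by blast
  from bchoice[OF this] show ?thesis using that by blast
qed

lemma sofic_reps_iff:
  assumes uf: "free_ultrafilter \<omega>" and G: "group G" and l: "lifts \<omega> G (n, \<Theta>) \<theta>"
  shows "(n, \<Theta>) \<in> sofic_reps \<omega> G \<longleftrightarrow>
    (\<forall>k. n k > 0) \<and> filterlim n at_top sequentially \<and>
    (\<forall>g\<in>carrier G. \<forall>h\<in>carrier G. near \<omega> n (\<theta> (g \<otimes>\<^bsub>G\<^esub> h)) (\<lambda>k. \<theta> g k \<circ> \<theta> h k)) \<and>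
    (\<forall>g\<in>carrier G. g \<noteq> \<one>\<^bsub>G\<^esub> \<longrightarrow> ((\<lambda>k. proportion (n k) (\<lambda>j. \<theta> g k j = j)) \<longlongrightarrow> 0) \<omega>)"
proof -
  interpret group G by (rule G)
  have p: "perm_seq n (\<theta> g)" and c: "\<Theta> g = perm_class \<omega> n (\<theta> g)" if "g \<in> carrier G" for g
    using l that by (simp_all add: lifts_def)
  have "\<Theta> \<in> hom G ((mat_ultra \<omega> n)\<lparr>carrier := perm_ultra \<omega> n\<rparr>) \<longleftrightarrow>
    (\<forall>g\<in>carrier G. \<forall>h\<in>carrier G. near \<omega> n (\<theta> (g \<otimes>\<^bsub>G\<^esub> h)) (\<lambda>k. \<theta> g k \<circ> \<theta> h k))"
  proof -
    have "\<Theta> \<in> carrier G \<rightarrow> perm_ultra \<omega> n" using p c by (auto simp: perm_ultra_eq)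
    moreover have "\<Theta> (g \<otimes>\<^bsub>G\<^esub> h) = \<Theta> g \<otimes>\<^bsub>mat_ultra \<omega> n\<^esub> \<Theta> h \<longleftrightarrow>
        near \<omega> n (\<theta> (g \<otimes>\<^bsub>G\<^esub> h)) (\<lambda>k. \<theta> g k \<circ> \<theta> h k)" if "g \<in> carrier G" "h \<in> carrier G" for g h
      using that p c by (simp add: perm_class_mult perm_class_eq_iff perm_seq_comp)
    ultimately show ?thesis by (simp add: hom_def)
  qed
  moreover have "ultra_tr \<omega> (\<Theta> g) = 0 \<longleftrightarrow> ((\<lambda>k. proportion (n k) (\<lambda>j. \<theta> g k j = j)) \<longlongrightarrow> 0) \<omega>"
    if "g \<in> carrier G" for g
    using ultra_tr_perm_class_eq_0_iff[OF uf p[OF that]] c[OF that] by simp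
  ultimately show ?thesis by (simp add: sofic_reps_def)
qed

lemma lifts_amplify:
  assumes "lifts \<omega> G (n, \<Theta>) \<theta>" "\<And>k. r k > 0"
  shows "lifts \<omega> G (amplify \<omega> r (n, \<Theta>)) (\<lambda>g k. amp (r k) (\<theta> g k))"
proof -
  have "fst (amplify \<omega> r (n, \<Theta>)) = (\<lambda>k. n k * r k)" by (simp add: amplify_def)
  then show ?thesis
    using assms by (simp add: lifts_def perm_seq_amp amplify_perm_class)
qed

lemma sof_equiv_iff:
  assumes l1: "lifts \<omega> G (n, \<Theta>\<^sub>1) \<theta>\<^sub>1" and l2: "lifts \<omega> G (m, \<Theta>\<^sub>2) \<theta>\<^sub>2"
  shows "((n, \<Theta>\<^sub>1), (m, \<Theta>\<^sub>2)) \<in> sof_equiv \<omega> G \<longleftrightarrow>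
    (n, \<Theta>\<^sub>1) \<in> sofic_reps \<omega> G \<and> (m, \<Theta>\<^sub>2) \<in> sofic_reps \<omega> G \<and>
    (\<exists>r t u. (\<forall>k. r k > 0 \<and> t k > 0 \<and> n k * r k = m k * t k) \<and> perm_seq (\<lambda>k. n k * r k) u \<and>
      (\<forall>g\<in>carrier G. near \<omega> (\<lambda>k. n k * r k)
        (\<lambda>k. amp (t k) (\<theta>\<^sub>2 g k) \<circ> u k) (\<lambda>k. u k \<circ> amp (r k) (\<theta>\<^sub>1 g k))))"
proof -
  have key: "snd (amplify \<omega> t (m, \<Theta>\<^sub>2)) g =
        ultra_Ad \<omega> (\<lambda>k. n k * r k) (perm_class \<omega> (\<lambda>k. n k * r k) u) (snd (amplify \<omega> r (n, \<Theta>\<^sub>1)) g) \<longleftrightarrow>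
      near \<omega> (\<lambda>k. n k * r k) (\<lambda>k. amp (t k) (\<theta>\<^sub>2 g k) \<circ> u k) (\<lambda>k. u k \<circ> amp (r k) (\<theta>\<^sub>1 g k))"
    if rt: "\<forall>k. r k > 0 \<and> t k > 0 \<and> n k * r k = m k * t k" and u: "perm_seq (\<lambda>k. n k * r k) u"
      and g: "g \<in> carrier G" for r t u g
  proof -
    have pos: "\<And>k. r k > 0" "\<And>k. t k > 0" and eq: "(\<lambda>k. m k * t k) = (\<lambda>k. n k * r k)"
      using rt by auto
    have p: "perm_seq (\<lambda>k. n k * r k) (\<lambda>k. amp (r k) (\<theta>\<^sub>1 g k))"
      "perm_seq (\<lambda>k. n k * r k) (\<lambda>k. amp (t k) (\<theta>\<^sub>2 g k))"
      and c: "snd (amplify \<omega> r (n, \<Theta>\<^sub>1)) g = perm_class \<omega> (\<lambda>k. n k * r k) (\<lambda>k. amp (r k) (\<theta>\<^sub>1 g k))"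
      "snd (amplify \<omega> t (m, \<Theta>\<^sub>2)) g = perm_class \<omega> (\<lambda>k. n k * r k) (\<lambda>k. amp (t k) (\<theta>\<^sub>2 g k))"
      using perm_seq_amp[where r = r and n = n and s = "\<theta>\<^sub>1 g"]
        perm_seq_amp[where r = t and n = m and s = "\<theta>\<^sub>2 g"]
        amplify_perm_class[where r = r and s = "\<theta>\<^sub>1 g" and \<Theta> = \<Theta>\<^sub>1]
        amplify_perm_class[where r = t and s = "\<theta>\<^sub>2 g" and \<Theta> = \<Theta>\<^sub>2] l1 l2 g pos
      by (simp_all add: lifts_def eq)
    show ?thesis
      unfolding c ultra_Ad_perm_class[OF u p(1)]
      by (simp add: perm_class_eq_iff p u perm_seq_comp perm_seq_inv near_conj_iff)
  qed
  show ?thesis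
    unfolding sof_equiv_def perm_ultra_eq using key by (simp (no_asm_simp)) blast
qed

lemma sof_equiv_reps:
  assumes "(\<Phi>, \<Psi>) \<in> sof_equiv \<omega> G"
  shows "\<Phi> \<in> sofic_reps \<omega> G" "\<Psi> \<in> sofic_reps \<omega> G"
  using assms by (auto simp: sof_equiv_def)

lemma sof_equiv_refl:
  assumes "\<Phi> \<in> sofic_reps \<omega> G"
  shows "(\<Phi>, \<Phi>) \<in> sof_equiv \<omega> G"
proof -
  obtain n \<Theta> where \<Phi>: "\<Phi> = (n, \<Theta>)" by (cases \<Phi>)
  obtain \<theta> where l: "lifts \<omega> G (n, \<Theta>) \<theta>" using sofic_reps_lifts assms \<Phi> by blast
  have "\<exists>r t u. (\<forall>k. r k > 0 \<and> t k > 0 \<and> n k * r k = n k * t k) \<and> perm_seq (\<lambda>k. n k * r k) u \<and>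
      (\<forall>g\<in>carrier G. near \<omega> (\<lambda>k. n k * r k)
        (\<lambda>k. amp (t k) (\<theta> g k) \<circ> u k) (\<lambda>k. u k \<circ> amp (r k) (\<theta> g k)))"
    by (rule exI[of _ "\<lambda>_. 1"], rule exI[of _ "\<lambda>_. 1"], rule exI[of _ "\<lambda>_. id"])
       (simp add: perm_seq_def permutes_id)
  then show ?thesis unfolding \<Phi> sof_equiv_iff[OF l l] using assms \<Phi> by simp
qed

lemma sof_equiv_sym:
  assumes "(\<Phi>, \<Psi>) \<in> sof_equiv \<omega> G"
  shows "(\<Psi>, \<Phi>) \<in> sof_equiv \<omega> G"
proof -
  obtain n \<Theta> m \<Xi> where eq: "\<Phi> = (n, \<Theta>)" "\<Psi> = (m, \<Xi>)" by (metis surj_pair)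
  note reps = sof_equiv_reps[OF assms, unfolded eq]
  obtain \<theta> \<xi> where l: "lifts \<omega> G (n, \<Theta>) \<theta>" "lifts \<omega> G (m, \<Xi>) \<xi>"
    using sofic_reps_lifts reps by metis
  obtain r t u where rt: "\<And>k. r k > 0 \<and> t k > 0 \<and> n k * r k = m k * t k"
    and u: "perm_seq (\<lambda>k. n k * r k) u"
    and near: "\<And>g. g \<in> carrier G \<Longrightarrow> near \<omega> (\<lambda>k. n k * r k)
        (\<lambda>k. amp (t k) (\<xi> g k) \<circ> u k) (\<lambda>k. u k \<circ> amp (r k) (\<theta> g k))"
    using assms unfolding eq sof_equiv_iff[OF l] by blast
  have D: "(\<lambda>k. m k * t k) = (\<lambda>k. n k * r k)" using rt by auto
  let ?v = "\<lambda>k. inv_into UNIV (u k)"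
  have v: "perm_seq (\<lambda>k. n k * r k) ?v" using u by (rule perm_seq_inv)
  have "near \<omega> (\<lambda>k. n k * r k) (\<lambda>k. amp (r k) (\<theta> g k) \<circ> ?v k) (\<lambda>k. ?v k \<circ> amp (t k) (\<xi> g k))"
    if g: "g \<in> carrier G" for g
  proof -
    let ?a = "\<lambda>k. amp (r k) (\<theta> g k)" and ?b = "\<lambda>k. amp (t k) (\<xi> g k)"
    have "perm_seq (\<lambda>k. m k * t k) ?b"
      using l(2) g rt by (intro perm_seq_amp) (simp_all add: lifts_def)
    then have "perm_seq (\<lambda>k. n k * r k) ?b" unfolding D .
    then have bu: "perm_seq (\<lambda>k. n k * r k) (\<lambda>k. ?b k \<circ> u k)" using u by (rule perm_seq_comp)
    have "near \<omega> (\<lambda>k. n k * r k) (\<lambda>k. (?v k \<circ> (?b k \<circ> u k)) \<circ> ?v k) (\<lambda>k. (?v k \<circ> (u k \<circ> ?a k)) \<circ> ?v k)"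
      by (intro near_comp near_refl near[OF g] bu v)
    moreover have "(?v k \<circ> (?b k \<circ> u k)) \<circ> ?v k = ?v k \<circ> ?b k" "(?v k \<circ> (u k \<circ> ?a k)) \<circ> ?v k = ?a k \<circ> ?v k" for k
      using perm_seq_inv_comp[OF u, of k] by (simp_all add: fun_eq_iff)
    ultimately show ?thesis by (simp add: near_sym)
  qed
  then have "\<forall>g\<in>carrier G. near \<omega> (\<lambda>k. m k * t k) (\<lambda>k. amp (r k) (\<theta> g k) \<circ> ?v k) (\<lambda>k. ?v k \<circ> amp (t k) (\<xi> g k))"
    unfolding D by blast
  moreover have "perm_seq (\<lambda>k. m k * t k) ?v" unfolding D by (rule v)
  moreover have "\<forall>k. t k > 0 \<and> r k > 0 \<and> m k * t k = n k * r k" using rt by simp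
  ultimately show ?thesis
    unfolding eq sof_equiv_iff[OF l(2,1)] using reps by blast
qed

text \<open>The middle representation occurs with multiplicity \<open>t\<close> in the first relation and \<open>r'\<close> in the second one. Amplifying
the first relation by \<open>r'\<close> and the second one by \<open>t\<close> gives it the multiplicity \<open>t r'\<close> in both, and by
\<open>amp_amp\<close> the two amplifications then coincide, so that the conjugating permutations can be composed.\<close>

lemma sof_equiv_trans:
  assumes 12: "(\<Phi>, \<Psi>) \<in> sof_equiv \<omega> G" and 23: "(\<Psi>, \<Upsilon>) \<in> sof_equiv \<omega> G"
  shows "(\<Phi>, \<Upsilon>) \<in> sof_equiv \<omega> G"
proof -
  obtain n \<Theta> m \<Xi> l \<Lambda> where eq: "\<Phi> = (n, \<Theta>)" "\<Psi> = (m, \<Xi>)" "\<Upsilon> = (l, \<Lambda>)" by (metis surj_pair)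
  note reps = sof_equiv_reps[OF 12, unfolded eq] sof_equiv_reps[OF 23, unfolded eq]
  obtain \<theta> \<xi> \<eta> where l: "lifts \<omega> G (n, \<Theta>) \<theta>" "lifts \<omega> G (m, \<Xi>) \<xi>" "lifts \<omega> G (l, \<Lambda>) \<eta>"
    using sofic_reps_lifts reps by metis
  obtain r t u where rt: "\<And>k. r k > 0 \<and> t k > 0 \<and> n k * r k = m k * t k"
    and u: "perm_seq (\<lambda>k. n k * r k) u"
    and near_u: "\<And>g. g \<in> carrier G \<Longrightarrow> near \<omega> (\<lambda>k. n k * r k)
        (\<lambda>k. amp (t k) (\<xi> g k) \<circ> u k) (\<lambda>k. u k \<circ> amp (r k) (\<theta> g k))"
    using 12 unfolding eq sof_equiv_iff[OF l(1,2)] by blast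
  obtain r' t' v where rt': "\<And>k. r' k > 0 \<and> t' k > 0 \<and> m k * r' k = l k * t' k"
    and v: "perm_seq (\<lambda>k. m k * r' k) v"
    and near_v: "\<And>g. g \<in> carrier G \<Longrightarrow> near \<omega> (\<lambda>k. m k * r' k)
        (\<lambda>k. amp (t' k) (\<eta> g k) \<circ> v k) (\<lambda>k. v k \<circ> amp (r' k) (\<xi> g k))"
    using 23 unfolding eq sof_equiv_iff[OF l(2,3)] by blast
  define D where "D = (\<lambda>k. n k * (r k * r' k))"
  have D1: "(\<lambda>k. (n k * r k) * r' k) = D" by (simp add: D_def mult.assoc)
  have D2: "(\<lambda>k. (m k * r' k) * t k) = D"
  proof
    fix k have "(m k * r' k) * t k = (m k * t k) * r' k" by simp
    also have "\<dots> = D k" using rt[of k] by (simp add: D_def)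
    finally show "(m k * r' k) * t k = D k" .
  qed
  have D3: "D k = l k * (t' k * t k)" for k
    using fun_cong[OF D2, of k] rt'[of k] by (simp add: mult.assoc)
  have pos: "\<And>k. r k > 0" "\<And>k. t k > 0" "\<And>k. r' k > 0" "\<And>k. t' k > 0" using rt rt' by auto
  let ?U = "\<lambda>k. amp (r' k) (u k)" and ?V = "\<lambda>k. amp (t k) (v k)"
  have U: "perm_seq D ?U" using perm_seq_amp[where r = r', OF pos(3) u] unfolding D1 .
  have V: "perm_seq D ?V" using perm_seq_amp[where r = t, OF pos(2) v] unfolding D2 .
  have "near \<omega> D (\<lambda>k. amp (t' k * t k) (\<eta> g k) \<circ> (?V k \<circ> ?U k)) (\<lambda>k. (?V k \<circ> ?U k) \<circ> amp (r k * r' k) (\<theta> g k))"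
    if g: "g \<in> carrier G" for g
  proof -
    have 1: "near \<omega> D (\<lambda>k. amp (t k * r' k) (\<xi> g k) \<circ> ?U k) (\<lambda>k. ?U k \<circ> amp (r k * r' k) (\<theta> g k))"
      using near_amp[where r = r', OF pos(3) near_u[OF g]] unfolding D1 amp_comp[OF pos(3)] amp_amp .
    have 2: "near \<omega> D (\<lambda>k. amp (t' k * t k) (\<eta> g k) \<circ> ?V k) (\<lambda>k. ?V k \<circ> amp (r' k * t k) (\<xi> g k))"
      using near_amp[where r = t, OF pos(2) near_v[OF g]] unfolding D2 amp_comp[OF pos(2)] amp_amp .
    have "perm_seq D (\<lambda>k. amp (t k * r' k) (\<xi> g k))"
    proof -
      have "perm_seq (\<lambda>k. m k * (t k * r' k)) (\<lambda>k. amp (t k * r' k) (\<xi> g k))"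
        using l(2) g pos by (intro perm_seq_amp) (simp_all add: lifts_def)
      moreover have "(\<lambda>k. m k * (t k * r' k)) = D"
        unfolding D2[symmetric] by (simp add: ac_simps)
      ultimately show ?thesis by simp
    qed
    then have "perm_seq D (\<lambda>k. amp (t k * r' k) (\<xi> g k) \<circ> ?U k)" using U by (rule perm_seq_comp)
    then have "near \<omega> D (\<lambda>k. ?V k \<circ> (amp (t k * r' k) (\<xi> g k) \<circ> ?U k)) (\<lambda>k. ?V k \<circ> (?U k \<circ> amp (r k * r' k) (\<theta> g k)))"
      by (intro near_comp near_refl 1)
    moreover have "near \<omega> D (\<lambda>k. (amp (t' k * t k) (\<eta> g k) \<circ> ?V k) \<circ> ?U k) (\<lambda>k. (?V k \<circ> amp (r' k * t k) (\<xi> g k)) \<circ> ?U k)"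
      by (intro near_comp near_refl 2 U)
    ultimately show ?thesis
      unfolding comp_assoc mult.commute[of "r' _"] by (rule near_trans[rotated])
  qed
  then have near: "\<forall>g\<in>carrier G. near \<omega> D (\<lambda>k. amp (t' k * t k) (\<eta> g k) \<circ> (?V k \<circ> ?U k))
      (\<lambda>k. (?V k \<circ> ?U k) \<circ> amp (r k * r' k) (\<theta> g k))"
    by blast
  have dims: "\<forall>k. r k * r' k > 0 \<and> t' k * t k > 0 \<and> n k * (r k * r' k) = l k * (t' k * t k)"
    using pos D3 by (simp add: D_def)
  have "\<exists>r t u. (\<forall>k. r k > 0 \<and> t k > 0 \<and> n k * r k = l k * t k) \<and> perm_seq (\<lambda>k. n k * r k) u \<and>
      (\<forall>g\<in>carrier G. near \<omega> (\<lambda>k. n k * r k)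
        (\<lambda>k. amp (t k) (\<eta> g k) \<circ> u k) (\<lambda>k. u k \<circ> amp (r k) (\<theta> g k)))"
    by (rule exI[of _ "\<lambda>k. r k * r' k"], rule exI[of _ "\<lambda>k. t' k * t k"], rule exI[of _ "\<lambda>k. ?V k \<circ> ?U k"],
        fold D_def) (intro conjI dims perm_seq_comp[OF V U] near)
  with reps(1,4) show ?thesis
    unfolding eq sof_equiv_iff[OF l(1,3)] by simp
qed

lemma sof_class_eq_iff:
  assumes "\<Phi> \<in> sofic_reps \<omega> G" "\<Psi> \<in> sofic_reps \<omega> G"
  shows "sof_class \<omega> G \<Phi> = sof_class \<omega> G \<Psi> \<longleftrightarrow> (\<Phi>, \<Psi>) \<in> sof_equiv \<omega> G"
  using assms sof_equiv_refl sof_equiv_sym sof_equiv_trans unfolding sof_class_def by blast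

section \<open>Convex combinations\<close>

lemma fst_convex_comb:
  "fst (convex_comb \<omega> n (\<lambda>i. (m i, \<Theta> i)) r) = (\<lambda>k. \<Sum>i=1..n. m i k * r i k)"
  by (simp add: convex_comb_def direct_sum_def amplify_def)

lemma convex_comb_eq:
  "convex_comb \<omega> n (\<lambda>i. (m i, \<Theta> i)) r =
    (\<lambda>k. \<Sum>i=1..n. m i k * r i k, snd (convex_comb \<omega> n (\<lambda>i. (m i, \<Theta> i)) r))"
  by (simp add: prod_eq_iff fst_convex_comb)

lemma lifts_convex_comb:
  assumes l: "\<And>i. i \<in> {1..n} \<Longrightarrow> lifts \<omega> G (m i, \<Theta> i) (\<theta> i)"
    and r: "\<And>i k. i \<in> {1..n} \<Longrightarrow> r i k > 0"
  shows "lifts \<omega> G (convex_comb \<omega> n (\<lambda>i. (m i, \<Theta> i)) r)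
    (\<lambda>g k. dirsum n (\<lambda>i. m i k * r i k) (\<lambda>i. amp (r i k) (\<theta> i g k)))"
  unfolding lifts_def fst_convex_comb
proof (intro ballI conjI)
  fix g assume g: "g \<in> carrier G"
  have fst: "fst (amplify \<omega> (r i) (m i, \<Theta> i)) = (\<lambda>k. m i k * r i k)" for i
    by (simp add: amplify_def)
  have la: "lifts \<omega> G (amplify \<omega> (r i) (m i, \<Theta> i)) (\<lambda>g k. amp (r i k) (\<theta> i g k))" if "i \<in> {1..n}" for i
    by (rule lifts_amplify[OF l[OF that]]) (rule r[OF that])
  show "perm_seq (\<lambda>k. \<Sum>i=1..n. m i k * r i k)
      (\<lambda>k. dirsum n (\<lambda>i. m i k * r i k) (\<lambda>i. amp (r i k) (\<theta> i g k)))"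
    by (rule perm_seq_dirsum) (use la g in \<open>simp add: lifts_def fst\<close>)
  show "snd (convex_comb \<omega> n (\<lambda>i. (m i, \<Theta> i)) r) g = perm_class \<omega> (\<lambda>k. \<Sum>i=1..n. m i k * r i k)
      (\<lambda>k. dirsum n (\<lambda>i. m i k * r i k) (\<lambda>i. amp (r i k) (\<theta> i g k)))"
    unfolding convex_comb_def
    by (subst direct_sum_perm_class[where s = "\<lambda>i k. amp (r i k) (\<theta> i g k)"])
       (use la g in \<open>simp_all add: lifts_def fst\<close>)
qed

lemma convex_comb_sofic:
  assumes uf: "free_ultrafilter \<omega>" and G: "group G" and n: "n \<ge> 1"
    and reps: "\<And>i. i \<in> {1..n} \<Longrightarrow> (m i, \<Theta> i) \<in> sofic_reps \<omega> G"
    and r: "\<And>i k. i \<in> {1..n} \<Longrightarrow> r i k > 0"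
  shows "convex_comb \<omega> n (\<lambda>i. (m i, \<Theta> i)) r \<in> sofic_reps \<omega> G"
proof -
  interpret group G by (rule G)
  obtain \<theta> where l: "\<And>i. i \<in> {1..n} \<Longrightarrow> lifts \<omega> G (m i, \<Theta> i) (\<theta> i)"
    using sofic_reps_lifts_family[of "{1..n}" "\<lambda>i. (m i, \<Theta> i)" \<omega> G] reps by blast
  note sofic = iffD1[OF sofic_reps_iff[OF uf G l] reps]
  let ?D = "\<lambda>k. \<Sum>i=1..n. m i k * r i k"
  let ?\<phi> = "\<lambda>g k. dirsum n (\<lambda>i. m i k * r i k) (\<lambda>i. amp (r i k) (\<theta> i g k))"
  have p: "\<theta> i g k permutes {..<m i k}" if "i \<in> {1..n}" "g \<in> carrier G" for i g k
    using l[OF that(1)] that(2) by (simp add: lifts_def perm_seq_def)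
  obtain \<Phi> where eq: "convex_comb \<omega> n (\<lambda>i. (m i, \<Theta> i)) r = (?D, \<Phi>)"
    by (rule that) (rule convex_comb_eq)
  have lc: "lifts \<omega> G (?D, \<Phi>) ?\<phi>"
    using lifts_convex_comb[where n = n and m = m and \<Theta> = \<Theta> and \<theta> = \<theta> and r = r, OF l r] by (simp only: eq)
  have one: "1 \<in> {1..n}" using n by simp
  have D_ge: "m 1 k \<le> ?D k" for k
  proof -
    have "m 1 k \<le> m 1 k * r 1 k" using r[OF one, of k] by simp
    also have "\<dots> \<le> ?D k" by (rule member_le_sum[OF one]) auto
    finally show ?thesis .
  qed
  show ?thesis
    unfolding eq sofic_reps_iff[OF uf G lc]
  proof (intro conjI allI ballI impI)
    fix k
    have "m 1 k > 0" using sofic[OF one one] by blast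
    then show "?D k > 0" using D_ge[of k] by linarith
  next
    show "filterlim ?D at_top sequentially"
      by (rule filterlim_at_top_mono[of "m 1"]) (use sofic[OF one one] D_ge in auto)
  next
    fix g h assume g: "g \<in> carrier G" and h: "h \<in> carrier G"
    have "near \<omega> ?D (?\<phi> (g \<otimes>\<^bsub>G\<^esub> h)) (\<lambda>k. dirsum n (\<lambda>i. m i k * r i k) (\<lambda>i. amp (r i k) (\<theta> i g k \<circ> \<theta> i h k)))"
      by (rule near_dirsum, rule near_amp, erule r) (use sofic g h in blast)
    moreover have "dirsum n (\<lambda>i. m i k * r i k) (\<lambda>i. amp (r i k) (\<theta> i g k \<circ> \<theta> i h k)) = ?\<phi> g k \<circ> ?\<phi> h k" for k
    proof -
      have "dirsum n (\<lambda>i. m i k * r i k) (\<lambda>i. amp (r i k) (\<theta> i g k \<circ> \<theta> i h k)) =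
          dirsum n (\<lambda>i. m i k * r i k) (\<lambda>i. amp (r i k) (\<theta> i g k) \<circ> amp (r i k) (\<theta> i h k))"
        by (rule dirsum_cong) (simp_all only: amp_comp[OF r])
      also have "\<dots> = ?\<phi> g k \<circ> ?\<phi> h k"
        by (rule dirsum_comp) (intro amp_permutes r p g h; assumption)+
      finally show ?thesis .
    qed
    ultimately show "near \<omega> ?D (?\<phi> (g \<otimes>\<^bsub>G\<^esub> h)) (\<lambda>k. ?\<phi> g k \<circ> ?\<phi> h k)" by simp
  next
    fix g assume g: "g \<in> carrier G" "g \<noteq> \<one>\<^bsub>G\<^esub>"
    show "((\<lambda>k. proportion (?D k) (\<lambda>j. ?\<phi> g k j = j)) \<longlongrightarrow> 0) \<omega>"
    proof (rule tendsto_zero_nonneg_le)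
      show "((\<lambda>k. \<Sum>i=1..n. proportion (m i k) (\<lambda>j. \<theta> i g k j = j)) \<longlongrightarrow> 0) \<omega>"
        using sofic g by (intro tendsto_null_sum) blast
      fix k
      have "proportion (?D k) (\<lambda>j. ?\<phi> g k j = j) \<le>
          (\<Sum>i=1..n. proportion (m i k * r i k) (\<lambda>q. \<theta> i g k (q div r i k) = q div r i k))"
      proof (rule proportion_dirsum_le)
        fix i q assume i: "i \<in> {1..n}" and q: "q < m i k * r i k"
          and fp: "?\<phi> g k (offset (\<lambda>i. m i k * r i k) i + q) = offset (\<lambda>i. m i k * r i k) i + q"
        have "amp (r i k) (\<theta> i g k) q = q"
          using fp dirsum_block[of i n q "\<lambda>i. m i k * r i k" "\<lambda>i. amp (r i k) (\<theta> i g k)"] i q by simp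
        then show "\<theta> i g k (q div r i k) = q div r i k" using amp_fixed_iff[OF r[OF i]] by blast
      qed
      also have "\<dots> = (\<Sum>i=1..n. proportion (m i k) (\<lambda>j. \<theta> i g k j = j))"
        by (intro sum.cong refl proportion_amp r)
      finally show "proportion (?D k) (\<lambda>j. ?\<phi> g k j = j) \<le> (\<Sum>i=1..n. proportion (m i k) (\<lambda>j. \<theta> i g k j = j))" .
    qed (rule proportion_nonneg)
  qed
qed

text \<open>After suitable amplifications, both convex combinations are direct sums over \<open>i\<close> of copies of
representations of the same size \<open>d i\<close> that are intertwined by \<open>u i\<close>, and admissibility makes the
numbers of copies asymptotically equal relative to the total dimension.\<close>

lemma convex_comb_equiv:
  assumes uf: "free_ultrafilter \<omega>" and G: "group G" and n: "n \<ge> 1"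
    and equiv: "\<And>i. i \<in> {1..n} \<Longrightarrow> ((m i, \<Theta> i), (m' i, \<Theta>' i)) \<in> sof_equiv \<omega> G"
    and adm: "admissible \<omega> n m w r" "admissible \<omega> n m' w r'"
  shows "(convex_comb \<omega> n (\<lambda>i. (m i, \<Theta> i)) r, convex_comb \<omega> n (\<lambda>i. (m' i, \<Theta>' i)) r') \<in> sof_equiv \<omega> G"
proof -
  have reps: "(m i, \<Theta> i) \<in> sofic_reps \<omega> G" "(m' i, \<Theta>' i) \<in> sofic_reps \<omega> G" if "i \<in> {1..n}" for i
    using sof_equiv_reps equiv[OF that] by blast+
  have rpos: "r i k > 0" "r' i k > 0" if "i \<in> {1..n}" for i k
    using adm that by (auto simp: admissible_def)
  obtain \<theta> where l: "\<And>i. i \<in> {1..n} \<Longrightarrow> lifts \<omega> G (m i, \<Theta> i) (\<theta> i)"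
    using sofic_reps_lifts_family[of "{1..n}" "\<lambda>i. (m i, \<Theta> i)" \<omega> G] reps(1) by blast
  obtain \<theta>' where l': "\<And>i. i \<in> {1..n} \<Longrightarrow> lifts \<omega> G (m' i, \<Theta>' i) (\<theta>' i)"
    using sofic_reps_lifts_family[of "{1..n}" "\<lambda>i. (m' i, \<Theta>' i)" \<omega> G] reps(2) by blast
  define conjugates where "conjugates i s t u \<longleftrightarrow>
    (\<forall>k. s k > 0 \<and> t k > 0 \<and> m i k * s k = m' i k * t k) \<and> perm_seq (\<lambda>k. m i k * s k) u \<and>
      (\<forall>g\<in>carrier G. near \<omega> (\<lambda>k. m i k * s k)
        (\<lambda>k. amp (t k) (\<theta>' i g k) \<circ> u k) (\<lambda>k. u k \<circ> amp (s k) (\<theta> i g k)))" for i s t u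
  have "\<exists>s t u. conjugates i s t u" if i: "i \<in> {1..n}" for i
    using iffD1[OF sof_equiv_iff[OF l[OF i] l'[OF i]] equiv[OF i]] unfolding conjugates_def by blast
  then obtain s t u where "\<And>i. i \<in> {1..n} \<Longrightarrow> conjugates i (s i) (t i) (u i)" by metis
  then have st: "\<And>i k. i \<in> {1..n} \<Longrightarrow> s i k > 0 \<and> t i k > 0 \<and> m i k * s i k = m' i k * t i k"
    and u: "\<And>i. i \<in> {1..n} \<Longrightarrow> perm_seq (\<lambda>k. m i k * s i k) (u i)"
    and near_u: "\<And>i g. i \<in> {1..n} \<Longrightarrow> g \<in> carrier G \<Longrightarrow> near \<omega> (\<lambda>k. m i k * s i k)
        (\<lambda>k. amp (t i k) (\<theta>' i g k) \<circ> u i k) (\<lambda>k. u i k \<circ> amp (s i k) (\<theta> i g k))"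
    unfolding conjugates_def by blast+
  define M where "M = (\<lambda>k. \<Sum>i=1..n. m i k * r i k)"
  define M' where "M' = (\<lambda>k. \<Sum>i=1..n. m' i k * r' i k)"
  \<comment> \<open>The factor \<open>Q\<close> makes the numbers of copies \<open>a i k\<close> and \<open>b i k\<close> exact quotients, and the factors \<open>M'\<close> and \<open>M\<close>
    in \<open>A\<close> and \<open>B\<close> equalize the total dimensions.\<close>
  define Q where "Q = (\<lambda>k. \<Prod>i=1..n. s i k * t i k)"
  define A where "A = (\<lambda>k. M' k * Q k)"
  define B where "B = (\<lambda>k. M k * Q k)"
  define d where "d = (\<lambda>i k. m i k * s i k)"
  define a where "a = (\<lambda>i k. r i k * (A k div s i k))"
  define b where "b = (\<lambda>i k. r' i k * (B k div t i k))"
  obtain \<Phi> where \<Phi>: "convex_comb \<omega> n (\<lambda>i. (m i, \<Theta> i)) r = (M, \<Phi>)"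
    by (rule that, unfold M_def) (rule convex_comb_eq)
  obtain \<Phi>' where \<Phi>': "convex_comb \<omega> n (\<lambda>i. (m' i, \<Theta>' i)) r' = (M', \<Phi>')"
    by (rule that, unfold M'_def) (rule convex_comb_eq)
  have sofic: "(M, \<Phi>) \<in> sofic_reps \<omega> G" "(M', \<Phi>') \<in> sofic_reps \<omega> G"
    unfolding \<Phi>[symmetric] \<Phi>'[symmetric]
    by (rule convex_comb_sofic[OF uf G n]; use reps rpos in blast)+
  let ?\<phi> = "\<lambda>g k. dirsum n (\<lambda>i. m i k * r i k) (\<lambda>i. amp (r i k) (\<theta> i g k))"
  let ?\<phi>' = "\<lambda>g k. dirsum n (\<lambda>i. m' i k * r' i k) (\<lambda>i. amp (r' i k) (\<theta>' i g k))"
  have lc: "lifts \<omega> G (M, \<Phi>) ?\<phi>" "lifts \<omega> G (M', \<Phi>') ?\<phi>'"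
    unfolding \<Phi>[symmetric] \<Phi>'[symmetric]
    by (rule lifts_convex_comb; use l l' rpos in blast)+
  have Mpos: "M k > 0" "M' k > 0" for k
    using sofic by (simp_all add: sofic_reps_def)
  have Qpos: "Q k > 0" for k
    unfolding Q_def by (rule prod_pos) (use st in auto)
  have pos: "A k > 0" "B k > 0" for k using Mpos[of k] Qpos[of k] by (simp_all add: A_def B_def)
  have dvd: "s i k dvd A k" "t i k dvd B k" if i: "i \<in> {1..n}" for i k
  proof -
    have "s i k * t i k dvd Q k" unfolding Q_def by (rule dvd_prodI[OF _ i]) simp
    then show "s i k dvd A k" "t i k dvd B k"
      unfolding A_def B_def by (metis dvd_mult dvd_mult_left dvd_mult_right)+
  qed
  have sa: "s i k * a i k = r i k * A k" and tb: "t i k * b i k = r' i k * B k" if "i \<in> {1..n}" for i k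
    using dvd_mult_div_cancel[OF dvd(1)[OF that, of k]] dvd_mult_div_cancel[OF dvd(2)[OF that, of k]]
    by (simp_all add: a_def b_def mult.left_commute)
  have da: "d i k * a i k = m i k * r i k * A k" and db: "d i k * b i k = m' i k * r' i k * B k"
    if "i \<in> {1..n}" for i k
    using sa[OF that, of k] tb[OF that, of k] st[OF that, of k] unfolding d_def
    by (metis mult.assoc)+
  have D: "(\<Sum>i=1..n. d i k * a i k) = M k * A k" "(\<Sum>i=1..n. d i k * b i k) = M' k * B k" for k
    unfolding M_def M'_def sum_distrib_right by (intro sum.cong refl da db; assumption)+
  have MA: "M k * A k = M' k * B k" for k by (simp add: A_def B_def)
  have lim: "((\<lambda>k. real (d i k * a i k) / real (\<Sum>i=1..n. d i k * a i k) -
      real (d i k * b i k) / real (\<Sum>i=1..n. d i k * a i k)) \<longlongrightarrow> 0) \<omega>" if i: "i \<in> {1..n}" for i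
  proof -
    have "real (d i k * a i k) / real (M k * A k) = real (m i k * r i k) / real (M k)" for k
      using pos[of k] by (simp add: da[OF i])
    moreover have "real (d i k * b i k) / real (M k * A k) = real (m' i k * r' i k) / real (M' k)" for k
      unfolding MA using pos[of k] by (simp add: db[OF i])
    moreover have "((\<lambda>k. real (m i k * r i k) / real (M k) - real (m' i k * r' i k) / real (M' k)) \<longlongrightarrow> w i - w i) \<omega>"
      using adm i unfolding admissible_def M_def M'_def by (intro tendsto_diff) blast+
    ultimately show ?thesis unfolding D by simp
  qed
  have eqD: "(\<Sum>i=1..n. d i k * a i k) = (\<Sum>i=1..n. d i k * b i k)" for k
    unfolding D by (rule MA)
  obtain U where U: "perm_seq (\<lambda>k. \<Sum>i=1..n. d i k * a i k) U"
    and near_U: "\<And>x y. (\<And>i. i \<in> {1..n} \<Longrightarrow> perm_seq (d i) (x i)) \<Longrightarrow>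
       (\<And>i. i \<in> {1..n} \<Longrightarrow> near \<omega> (d i) (\<lambda>k. y i k \<circ> u i k) (\<lambda>k. u i k \<circ> x i k)) \<Longrightarrow>
       near \<omega> (\<lambda>k. \<Sum>i=1..n. d i k * a i k)
         (\<lambda>k. dirsum n (\<lambda>i. d i k * b i k) (\<lambda>i. amp (b i k) (y i k)) \<circ> U k)
         (\<lambda>k. U k \<circ> dirsum n (\<lambda>i. d i k * a i k) (\<lambda>i. amp (a i k) (x i k)))"
    by (rule matching_near[where n = n and d = d and a = a and b = b and u = u and \<omega> = \<omega>, OF eqD _ lim]) (use u in \<open>auto simp: d_def\<close>)
  have "near \<omega> (\<lambda>k. M k * A k) (\<lambda>k. amp (B k) (?\<phi>' g k) \<circ> U k) (\<lambda>k. U k \<circ> amp (A k) (?\<phi> g k))"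
    if g: "g \<in> carrier G" for g
  proof -
    have p: "\<theta> i g k permutes {..<m i k}" "\<theta>' i g k permutes {..<m' i k}" if "i \<in> {1..n}" for i k
      using l[OF that] l'[OF that] g by (simp_all add: lifts_def perm_seq_def)
    have "amp (A k) (?\<phi> g k) = dirsum n (\<lambda>i. d i k * a i k) (\<lambda>i. amp (a i k) (amp (s i k) (\<theta> i g k)))" for k
    proof -
      have "amp (A k) (?\<phi> g k) = dirsum n (\<lambda>i. m i k * r i k * A k) (\<lambda>i. amp (A k) (amp (r i k) (\<theta> i g k)))"
        by (rule amp_dirsum[OF pos(1)]) (intro amp_permutes rpos p; assumption)
      also have "\<dots> = dirsum n (\<lambda>i. d i k * a i k) (\<lambda>i. amp (a i k) (amp (s i k) (\<theta> i g k)))"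
        unfolding amp_amp by (rule dirsum_cong) (simp_all only: da sa)
      finally show ?thesis .
    qed
    moreover have "amp (B k) (?\<phi>' g k) = dirsum n (\<lambda>i. d i k * b i k) (\<lambda>i. amp (b i k) (amp (t i k) (\<theta>' i g k)))" for k
    proof -
      have "amp (B k) (?\<phi>' g k) = dirsum n (\<lambda>i. m' i k * r' i k * B k) (\<lambda>i. amp (B k) (amp (r' i k) (\<theta>' i g k)))"
        by (rule amp_dirsum[OF pos(2)]) (intro amp_permutes rpos p; assumption)
      also have "\<dots> = dirsum n (\<lambda>i. d i k * b i k) (\<lambda>i. amp (b i k) (amp (t i k) (\<theta>' i g k)))"
        unfolding amp_amp by (rule dirsum_cong) (simp_all only: db tb)
      finally show ?thesis .
    qed
    moreover have "perm_seq (d i) (\<lambda>k. amp (s i k) (\<theta> i g k))" if "i \<in> {1..n}" for i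
      unfolding d_def perm_seq_def using st[OF that] p[OF that] by (intro allI amp_permutes) auto
    ultimately show ?thesis
      using near_U[of "\<lambda>i k. amp (s i k) (\<theta> i g k)" "\<lambda>i k. amp (t i k) (\<theta>' i g k)"] near_u[OF _ g]
      unfolding D(1) by (simp add: d_def)
  qed
  then have near: "\<forall>g\<in>carrier G. near \<omega> (\<lambda>k. M k * A k)
      (\<lambda>k. amp (B k) (?\<phi>' g k) \<circ> U k) (\<lambda>k. U k \<circ> amp (A k) (?\<phi> g k))"
    by blast
  have dims: "\<forall>k. A k > 0 \<and> B k > 0 \<and> M k * A k = M' k * B k"
    using pos MA by blast
  have "\<exists>r t u. (\<forall>k. r k > 0 \<and> t k > 0 \<and> M k * r k = M' k * t k) \<and> perm_seq (\<lambda>k. M k * r k) u \<and>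
      (\<forall>g\<in>carrier G. near \<omega> (\<lambda>k. M k * r k)
        (\<lambda>k. amp (t k) (?\<phi>' g k) \<circ> u k) (\<lambda>k. u k \<circ> amp (r k) (?\<phi> g k)))"
    by (rule exI[of _ A], rule exI[of _ B], rule exI[of _ U]) (intro conjI dims near U[unfolded D(1)])
  with sofic show ?thesis
    unfolding \<Phi> \<Phi>' sof_equiv_iff[OF lc] by blast
qed

theorem proposition2p2:
  fixes \<omega> :: "nat filter" and G :: "('g, 'h) monoid_scheme" and n :: nat
    and m m' :: "nat \<Rightarrow> nat \<Rightarrow> nat"
    and \<Theta> \<Theta>' :: "nat \<Rightarrow> 'g \<Rightarrow> (nat \<Rightarrow> complex mat) set"
    and w :: "nat \<Rightarrow> real" and r r' :: "nat \<Rightarrow> nat \<Rightarrow> nat"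
  assumes "free_ultrafilter \<omega>"
    and "group G" and "countable (carrier G)"
    and "n \<ge> 1"
    and "\<forall>i\<in>{1..n}. (m i, \<Theta> i) \<in> sofic_reps \<omega> G"
    and "\<forall>i\<in>{1..n}. (m' i, \<Theta>' i) \<in> sofic_reps \<omega> G"
    and "\<forall>i\<in>{1..n}. sof_class \<omega> G (m i, \<Theta> i) = sof_class \<omega> G (m' i, \<Theta>' i)"
    and "\<forall>i\<in>{1..n}. w i \<ge> 0" and "(\<Sum>i=1..n. w i) = 1"
    and "admissible \<omega> n m w r" and "admissible \<omega> n m' w r'"
  shows "sof_class \<omega> G (convex_comb \<omega> n (\<lambda>i. (m i, \<Theta> i)) r) \<in> Sof \<omega> G \<and>
         sof_class \<omega> G (convex_comb \<omega> n (\<lambda>i. (m i, \<Theta> i)) r) =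
         sof_class \<omega> G (convex_comb \<omega> n (\<lambda>i. (m' i, \<Theta>' i)) r')"
proof -
  have "((m i, \<Theta> i), (m' i, \<Theta>' i)) \<in> sof_equiv \<omega> G" if "i \<in> {1..n}" for i
  proof -
    have "(m i, \<Theta> i) \<in> sofic_reps \<omega> G" "(m' i, \<Theta>' i) \<in> sofic_reps \<omega> G"
      and "sof_class \<omega> G (m i, \<Theta> i) = sof_class \<omega> G (m' i, \<Theta>' i)"
      using assms(5-7) that by blast+
    then show ?thesis by (rule iffD1[OF sof_class_eq_iff])
  qed
  then have "(convex_comb \<omega> n (\<lambda>i. (m i, \<Theta> i)) r, convex_comb \<omega> n (\<lambda>i. (m' i, \<Theta>' i)) r') \<in> sof_equiv \<omega> G"
    by (rule convex_comb_equiv[OF assms(1,2,4) _ assms(10,11)])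
  note comb = sof_equiv_reps[OF this] this
  show ?thesis
  proof
    show "sof_class \<omega> G (convex_comb \<omega> n (\<lambda>i. (m i, \<Theta> i)) r) \<in> Sof \<omega> G"
      unfolding Sof_def sof_class_def by (rule quotientI) (rule comb(1))
    show "sof_class \<omega> G (convex_comb \<omega> n (\<lambda>i. (m i, \<Theta> i)) r) =
        sof_class \<omega> G (convex_comb \<omega> n (\<lambda>i. (m' i, \<Theta>' i)) r')"
      by (rule iffD2[OF sof_class_eq_iff[OF comb(1,2)] comb(3)])
  qed
qed

end
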